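(* Let $n\ge2$. For $1\le k\le n-1$, the set $\{E_k\Delta_n\}$ is a basis of $A_n^{k,1}$, so $\dim A_n^{k,1}=1$. For every other integer $k$, $\dim A_n^{k,1}=0$.
   Context: $A_n$ is the space of $P\in\mathbb{Q}[x_1,\dots,x_n,y_1,\dots,y_n]$ with $\sum_{i=1}^n\partial_{x_i}^a\partial_{y_i}^bP=0$ for all $a,b\ge0$ with $a+b>0$, which are alternating under the diagonal action of $S_n$ ($\sigma P=P(x_{\sigma(1)},\dots,x_{\sigma(n)},y_{\sigma(1)},\dots,y_{\sigma(n)})=\mathrm{sgn}(\sigma)P$). $A_n^{k,l}$ is the subspace of elements bihomogeneous of degree $\frac{n(n-1)}2-k$ in the $x$'s and $l$ in the $y$'s. $\Delta_n=\det\big(x_i^{n-j}/(n-j)!\big)_{i,j=1}^n$ and $E_a=\sum_{i=1}^ny_i\partial_{x_i}^a$ for $a>0$. *)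

theory Defs
  imports
    "HOL-Library.Poly_Mapping"
    "HOL-Combinatorics.Permutations"
    "Jordan_Normal_Form.Determinant"
begin

datatype var = X nat | Y nat

text \<open>
  Monomials are finitely supported exponent functions; multiplication of polynomials is the
  convolution product provided by \<open>Poly_Mapping\<close>.
\<close>

type_synonym monom = "var \<Rightarrow>\<^sub>0 nat"
type_synonym qpoly = "monom \<Rightarrow>\<^sub>0 rat"

definition Const :: "rat \<Rightarrow> qpoly"
  where "Const c = Poly_Mapping.single 0 c"

definition Var :: "var \<Rightarrow> qpoly"
  where "Var v = Poly_Mapping.single (Poly_Mapping.single v 1) 1"

definition scale :: "rat \<Rightarrow> qpoly \<Rightarrow> qpoly"
  where "scale c P = Const c * P"

interpretation qpoly: vector_space scale
proof
  fix a b :: rat and x y :: qpoly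
  show "scale a (x + y) = scale a x + scale a y"
    by (simp add: scale_def distrib_left)
  show "scale (a + b) x = scale a x + scale b x"
    by (simp add: scale_def Const_def single_add distrib_right)
  show "scale a (scale b x) = scale (a * b) x"
    by (simp add: scale_def Const_def mult_single flip: mult.assoc)
  show "scale 1 x = x"
    by (simp add: scale_def Const_def)
qed

definition polys :: "nat \<Rightarrow> qpoly set"
  where "polys n =
    {P. \<forall>m \<in> Poly_Mapping.keys P. Poly_Mapping.keys m \<subseteq> X ` {1..n} \<union> Y ` {1..n}}"

definition pderiv_var :: "var \<Rightarrow> qpoly \<Rightarrow> qpoly"
  where "pderiv_var v P =
    (\<Sum>m \<in> Poly_Mapping.keys P.
      Poly_Mapping.single (m - Poly_Mapping.single v 1)
        (of_nat (Poly_Mapping.lookup m v) * Poly_Mapping.lookup P m))"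

definition subst :: "(var \<Rightarrow> qpoly) \<Rightarrow> qpoly \<Rightarrow> qpoly"
  where "subst f P =
    (\<Sum>m \<in> Poly_Mapping.keys P.
      Const (Poly_Mapping.lookup P m) *
        (\<Prod>v \<in> Poly_Mapping.keys m. f v ^ Poly_Mapping.lookup m v))"

fun perm_var :: "(nat \<Rightarrow> nat) \<Rightarrow> var \<Rightarrow> var" where
  "perm_var \<sigma> (X i) = X (\<sigma> i)"
| "perm_var \<sigma> (Y i) = Y (\<sigma> i)"

definition perm_act :: "(nat \<Rightarrow> nat) \<Rightarrow> qpoly \<Rightarrow> qpoly"
  where "perm_act \<sigma> = subst (\<lambda>v. Var (perm_var \<sigma> v))"

definition alternating :: "nat \<Rightarrow> qpoly \<Rightarrow> bool"
  where "alternating n P \<longleftrightarrow>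
    (\<forall>\<sigma>. \<sigma> permutes {1..n} \<longrightarrow> perm_act \<sigma> P = scale (of_int (sign \<sigma>)) P)"

definition diag_harmonic :: "nat \<Rightarrow> qpoly \<Rightarrow> bool"
  where "diag_harmonic n P \<longleftrightarrow>
    (\<forall>a b. a + b > 0 \<longrightarrow>
      (\<Sum>i = 1..n. (pderiv_var (X i) ^^ a) ((pderiv_var (Y i) ^^ b) P)) = 0)"

definition A :: "nat \<Rightarrow> qpoly set"
  where "A n = {P \<in> polys n. diag_harmonic n P \<and> alternating n P}"

definition xdeg :: "nat \<Rightarrow> monom \<Rightarrow> nat"
  where "xdeg n m = (\<Sum>i = 1..n. Poly_Mapping.lookup m (X i))"

definition ydeg :: "nat \<Rightarrow> monom \<Rightarrow> nat"
  where "ydeg n m = (\<Sum>i = 1..n. Poly_Mapping.lookup m (Y i))"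

text \<open>
  The index \<open>k\<close> is an arbitrary integer. The zero polynomial is bihomogeneous of every bidegree,
  so \<open>A_bideg n k l\<close> is a subspace, and it is zero when the required x-degree is negative.
\<close>

definition A_bideg :: "nat \<Rightarrow> int \<Rightarrow> nat \<Rightarrow> qpoly set"
  where "A_bideg n k l =
    {P \<in> A n. \<forall>m \<in> Poly_Mapping.keys P.
      int (xdeg n m) = int (n * (n - 1) div 2) - k \<and> ydeg n m = l}"

text \<open>
  Matrices of the type \<open>mat\<close> are indexed from 0, so row \<open>i\<close> belongs to the
  variable with index \<open>Suc i\<close> and column \<open>j\<close> to the exponent \<open>n - Suc j\<close>.
\<close>

definition Delta :: "nat \<Rightarrow> qpoly"
  where "Delta n =
    Determinant.det (mat n n
      (\<lambda>(i, j). scale (1 / fact (n - Suc j)) (Var (X (Suc i)) ^ (n - Suc j))))"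

definition E :: "nat \<Rightarrow> nat \<Rightarrow> qpoly \<Rightarrow> qpoly"
  where "E n a P = (\<Sum>i = 1..n. Var (Y i) * (pderiv_var (X i) ^^ a) P)"

end

theory Submission
  imports Defs "HOL-Computational_Algebra.Formal_Power_Series"
begin

text \<open>
  Multiply the coefficient of a monomial \<open>m\<close> by \<open>m!\<close>. Partial derivatives then become shifts
  of exponents, and harmonicity in the \<open>x\<close> variables says that the linear functional
  \<open>m \<mapsto> C m\<close> on polynomials vanishes on the ideal generated by the power sums
  \<open>p\<^sub>a = \<Sum>\<^sub>i x\<^sub>i\<^sup>a\<close>, \<open>a \<ge> 1\<close>. By Newton's identities this
  ideal contains every \<open>x\<^sub>i\<^sup>n\<close>, so \<open>C\<close> lives on exponents below \<open>n\<close>.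

  Let \<open>C\<close> be alternating, of degree 1 in the \<open>y\<close> variables. Up to a permutation a monomial
  with \<open>C m \<noteq> 0\<close> is \<open>y\<^sub>n x\<^sub>n\<^sup>r\<close> times a monomial in \<open>x\<^sub>1, \<dots>, x\<^sub>n\<^sub>-\<^sub>1\<close>
  with distinct exponents, which must be \<open>{0, \<dots>, n - 1} - {v}\<close>; write \<open>t v r\<close> for the value of
  \<open>C\<close>. The relation for \<open>p\<^sub>1\<close> reads \<open>t v (r + 1) = - t (v - 1) r\<close>, with right-hand side 0
  if \<open>v = 0\<close>. In x-degree \<open>n (n - 1) / 2 - k\<close> we have \<open>r = v - k\<close>, so everything is determined
  by \<open>t k 0\<close> if \<open>0 \<le> k < n\<close>, and vanishes otherwise. Since \<open>E\<^sub>k \<Delta>\<^sub>n\<close> has \<open>t k 0 \<noteq> 0\<close>,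
  it spans. For \<open>k = 0\<close> the remaining condition \<open>\<Sum>\<^sub>i \<partial>\<^sub>y\<^sub>i P = 0\<close> excludes
  \<open>E\<^sub>0 \<Delta>\<^sub>n = (\<Sum>\<^sub>i y\<^sub>i) \<Delta>\<^sub>n\<close>.
\<close>

subsection \<open>Powers in the ideal of the power sums\<close>

lemma geometric_fps:
  fixes u :: "'a::comm_ring_1"
  shows "(1 - fps_const u * fps_X) * Abs_fps (\<lambda>a. u ^ a) = 1"
proof (rule fps_ext)
  fix n
  show "fps_nth ((1 - fps_const u * fps_X) * Abs_fps (\<lambda>a. u ^ a)) n = fps_nth 1 n"
    by (cases n) (simp_all add: left_diff_distrib mult.assoc)
qed

text \<open>This is the logarithmic derivative of the product, the generating-function form of
  Newton's identities. Over a commutative ring no factor is divided out: the geometric series plays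
  the inverse of \<open>1 - z j X\<close>, and in the induction step their product is inserted as a
  factor 1.\<close>

lemma fps_deriv_prod_linear:
  fixes z :: "'i \<Rightarrow> 'a::comm_ring_1"
  assumes "finite S"
  shows "fps_deriv (\<Prod>i\<in>S. 1 - fps_const (z i) * fps_X) =
    - (\<Prod>i\<in>S. 1 - fps_const (z i) * fps_X) * (\<Sum>i\<in>S. fps_const (z i) * Abs_fps (\<lambda>a. z i ^ a))"
  using assms
proof (induction S)
  case empty
  then show ?case by simp
next
  case (insert j S)
  let ?L = "1 - fps_const (z j) * fps_X"
  let ?G = "Abs_fps (\<lambda>a. z j ^ a)"
  let ?F = "\<Prod>i\<in>S. 1 - fps_const (z i) * fps_X"
  let ?T = "\<Sum>i\<in>S. fps_const (z i) * Abs_fps (\<lambda>a. z i ^ a)"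
  have d: "fps_deriv ?L = - fps_const (z j)" by simp
  have "fps_deriv (?L * ?F) = ?L * (- ?F * ?T) + (- fps_const (z j)) * ?F"
    by (simp only: fps_deriv_mult d insert.IH)
  also have "\<dots> = - (?L * ?F) * ?T - (?L * ?G) * fps_const (z j) * ?F"
    by (simp only: geometric_fps) (simp add: algebra_simps del: fps_const_neg)
  also have "\<dots> = - (?L * ?F) * (fps_const (z j) * ?G + ?T)"
    by (simp add: algebra_simps)
  finally show ?case using insert by simp
qed

lemma fps_nth_prod_linear_eq_0:
  fixes z :: "'i \<Rightarrow> 'a::comm_ring_1"
  assumes "finite S" "card S < k"
  shows "fps_nth (\<Prod>i\<in>S. 1 - fps_const (z i) * fps_X) k = 0"
  using assms
proof (induction S arbitrary: k)
  case empty
  then show ?case by simp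
next
  case (insert j S)
  then obtain l where k: "k = Suc l" by (cases k) auto
  then show ?case using insert by (simp add: left_diff_distrib mult.assoc)
qed

text \<open>The coefficients of \<open>F\<close>, the product of all \<open>1 - z i X\<close>, are
  signed elementary symmetric functions. Newton's identities place those of positive degree in
  \<open>I\<close>; the assumption \<open>div\<close> replaces division by integers. Cancelling the
  factor of \<open>i\<close> leaves degree below \<open>card S\<close>, so the vanishing coefficient
  at \<open>card S\<close> expresses \<open>z i ^ card S\<close> through them.\<close>

lemma power_card_in_ideal:
  fixes z :: "'i \<Rightarrow> 'a::comm_ring_1" and I :: "'a set"
  assumes fin: "finite S" and i: "i \<in> S"
    and zero: "0 \<in> I"
    and add: "\<And>x y. x \<in> I \<Longrightarrow> y \<in> I \<Longrightarrow> x + y \<in> I"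
    and mult: "\<And>x y. x \<in> I \<Longrightarrow> y * x \<in> I"
    and div: "\<And>k x. of_nat (Suc k) * x \<in> I \<Longrightarrow> x \<in> I"
    and p: "\<And>a. a \<ge> 1 \<Longrightarrow> (\<Sum>i\<in>S. z i ^ a) \<in> I"
  shows "z i ^ card S \<in> I"
proof -
  define F where "F = (\<Prod>i\<in>S. 1 - fps_const (z i) * fps_X)"
  let ?G = "\<lambda>i. Abs_fps (\<lambda>a. z i ^ a)"
  have sum_in: "sum f T \<in> I" if "\<And>j. j \<in> T \<Longrightarrow> f j \<in> I" for f and T :: "nat set"
    using that by (induction T rule: infinite_finite_induct) (auto intro: zero add)
  have F: "fps_nth F (Suc k) \<in> I" for k
  proof -
    \<comment> \<open>Compare coefficients in the logarithmic derivative. The power sums that appear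
      have exponent \<open>Suc (k - j)\<close>, which is never 0, so \<open>p\<close> applies to all
      of them.\<close>
    have "of_nat (Suc k) * fps_nth F (Suc k) = fps_nth (fps_deriv F) k" by (simp add: algebra_simps)
    also have "\<dots> = - fps_nth (F * (\<Sum>i\<in>S. fps_const (z i) * ?G i)) k"
      unfolding F_def fps_deriv_prod_linear[OF fin] by simp
    also have "\<dots> = (\<Sum>j\<le>k. (- fps_nth F j) * (\<Sum>i\<in>S. z i ^ Suc (k - j)))"
      by (subst fps_mult_nth) (simp add: fps_sum_nth sum_negf atMost_atLeast0)
    also have "\<dots> \<in> I"
      by (intro sum_in mult p) simp
    finally show ?thesis by (rule div)
  qed
  have "F * ?G i = (\<Prod>i\<in>S - {i}. 1 - fps_const (z i) * fps_X)"
  proof -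
    have "F * ?G i = ((1 - fps_const (z i) * fps_X) * ?G i) * (\<Prod>i\<in>S - {i}. 1 - fps_const (z i) * fps_X)"
      unfolding F_def prod.remove[OF fin i] by (simp only: ac_simps)
    then show ?thesis by (simp only: geometric_fps mult_1_left)
  qed
  moreover have "card (S - {i}) < card S" using fin i by (rule card_Diff1_less)
  ultimately have "fps_nth (F * ?G i) (card S) = 0"
    using fps_nth_prod_linear_eq_0[of "S - {i}" "card S" z] fin by simp
  moreover have "fps_nth F 0 = 1"
    unfolding F_def by (induction S rule: infinite_finite_induct) auto
  \<comment> \<open>The coefficient at \<open>card S\<close> is expanded as a convolution, with the
    term of the constant coefficient 1 of \<open>F\<close> split off.\<close>
  ultimately have eq: "0 = z i ^ card S + (\<Sum>j\<in>{0<..card S}. fps_nth F j * z i ^ (card S - j))"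
    by (simp add: fps_mult_nth sum.head)
  have "(\<Sum>j\<in>{0<..card S}. fps_nth F j * z i ^ (card S - j)) \<in> I"
  proof (rule sum_in)
    fix j assume "j \<in> {0<..card S}"
    then obtain l where "j = Suc l" by (cases j) auto
    then show "fps_nth F j * z i ^ (card S - j) \<in> I"
      using mult[OF F[of l], of "z i ^ (card S - j)"] by (simp add: mult.commute)
  qed
  moreover from eq have "z i ^ card S = -1 * (\<Sum>j\<in>{0<..card S}. fps_nth F j * z i ^ (card S - j))"
    by (simp add: eq_neg_iff_add_eq_0)
  ultimately show ?thesis by (simp only: mult)
qed

subsection \<open>Normalised coefficients\<close>

abbreviation x_pow :: "nat \<Rightarrow> nat \<Rightarrow> monom"
  where "x_pow i a \<equiv> Poly_Mapping.single (X i) a"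

abbreviation y_pow :: "nat \<Rightarrow> nat \<Rightarrow> monom"
  where "y_pow i a \<equiv> Poly_Mapping.single (Y i) a"

definition mfact :: "monom \<Rightarrow> rat"
  where "mfact m = (\<Prod>v\<in>Poly_Mapping.keys m. fact (Poly_Mapping.lookup m v))"

definition divided_coeff :: "qpoly \<Rightarrow> monom \<Rightarrow> rat"
  where "divided_coeff P m = mfact m * Poly_Mapping.lookup P m"

definition permute_monom :: "(nat \<Rightarrow> nat) \<Rightarrow> monom \<Rightarrow> monom"
  where "permute_monom \<sigma> m =
    (\<Sum>v\<in>Poly_Mapping.keys m. Poly_Mapping.single (perm_var \<sigma> v) (Poly_Mapping.lookup m v))"

lemma mfact_superset:
  assumes "finite S" "Poly_Mapping.keys m \<subseteq> S"
  shows "mfact m = (\<Prod>v\<in>S. fact (Poly_Mapping.lookup m v))"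
  unfolding mfact_def
  by (rule prod.mono_neutral_left) (use assms in \<open>auto simp: in_keys_iff\<close>)

lemma mfact_nonzero [simp]: "mfact m \<noteq> 0"
  by (simp add: mfact_def)

lemma mfact_add_single:
  "mfact (m + Poly_Mapping.single v 1) = of_nat (Suc (Poly_Mapping.lookup m v)) * mfact m"
proof -
  let ?S = "insert v (Poly_Mapping.keys m)"
  have "Poly_Mapping.keys (m + Poly_Mapping.single v 1) \<subseteq> ?S"
    using keys_add[of m "Poly_Mapping.single v 1"] by auto
  then have "mfact (m + Poly_Mapping.single v 1) =
      (\<Prod>w\<in>?S. fact (Poly_Mapping.lookup (m + Poly_Mapping.single v 1) w))"
    by (intro mfact_superset) auto
  also have "\<dots> = fact (Suc (Poly_Mapping.lookup m v)) *
      (\<Prod>w\<in>?S - {v}. fact (Poly_Mapping.lookup m w))"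
    by (subst prod.remove[of _ v]) (auto simp: lookup_add lookup_single when_def intro!: prod.cong split: if_splits)
  also have "\<dots> = of_nat (Suc (Poly_Mapping.lookup m v)) *
      (fact (Poly_Mapping.lookup m v) * (\<Prod>w\<in>?S - {v}. fact (Poly_Mapping.lookup m w)))"
    by simp
  also have "fact (Poly_Mapping.lookup m v) * (\<Prod>w\<in>?S - {v}. fact (Poly_Mapping.lookup m w)) = mfact m"
    by (subst mfact_superset[of ?S]) (auto simp: prod.remove[of ?S v])
  finally show ?thesis .
qed

lemma divided_coeff_eq_0_iff [simp]:
  "divided_coeff P m = 0 \<longleftrightarrow> m \<notin> Poly_Mapping.keys P"
  by (simp add: divided_coeff_def in_keys_iff)

lemma divided_coeff_inject: "divided_coeff P = divided_coeff Q \<longleftrightarrow> P = Q"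
  by (auto simp: divided_coeff_def fun_eq_iff intro: poly_mapping_eqI)

lemma divided_coeff_zero [simp]: "divided_coeff 0 m = 0"
  by (simp add: divided_coeff_def)

lemma divided_coeff_diff: "divided_coeff (P - Q) m = divided_coeff P m - divided_coeff Q m"
  by (simp add: divided_coeff_def lookup_minus algebra_simps)

lemma divided_coeff_sum: "divided_coeff (sum f S) m = (\<Sum>i\<in>S. divided_coeff (f i) m)"
  by (simp add: divided_coeff_def lookup_sum sum_distrib_left)

lemma lookup_single_times:
  fixes P :: qpoly
  shows "Poly_Mapping.lookup (Poly_Mapping.single m c * P) (m + m') = c * Poly_Mapping.lookup P m'"
proof -
  have "(\<Sum>l. Poly_Mapping.lookup (Poly_Mapping.single m c) l * (\<Sum>q. Poly_Mapping.lookup P q when m + m' = l + q))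
      = (\<Sum>l. c * Poly_Mapping.lookup P m' when l = m)"
    by (intro Sum_any.cong) (auto simp: lookup_single when_def)
  then show ?thesis by (simp add: lookup_mult)
qed

lemma lookup_single_times_0:
  fixes P :: qpoly
  assumes "\<And>m'. m'' \<noteq> m + m'"
  shows "Poly_Mapping.lookup (Poly_Mapping.single m c * P) m'' = 0"
proof (rule ccontr)
  assume "\<not> ?thesis"
  then have "m'' \<in> Poly_Mapping.keys (Poly_Mapping.single m c * P)" by (simp add: in_keys_iff)
  with keys_mult[of "Poly_Mapping.single m c" P] assms show False
    by (auto split: if_splits)
qed

lemma lookup_scale: "Poly_Mapping.lookup (scale c P) m = c * Poly_Mapping.lookup P m"
  using lookup_single_times[of 0 c P m] by (simp add: scale_def Const_def)

lemma divided_coeff_scale: "divided_coeff (scale c P) m = c * divided_coeff P m"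
  by (simp add: divided_coeff_def lookup_scale)

lemma single_1_add_diff:
  assumes "Poly_Mapping.lookup m v \<noteq> (0::nat)"
  shows "Poly_Mapping.single v 1 + (m - Poly_Mapping.single v 1) = m"
  using assms by (intro poly_mapping_eqI) (auto simp: lookup_add lookup_minus lookup_single when_def)

text \<open>The factorial normalisation turns multiplication by a variable into a weighted shift. If
  \<open>v\<close> does not occur in \<open>m\<close>, the truncated difference is meaningless, but
  its factor is 0.\<close>

lemma divided_coeff_Var_times:
  "divided_coeff (Var v * P) m =
    of_nat (Poly_Mapping.lookup m v) * divided_coeff P (m - Poly_Mapping.single v 1)"
proof (cases "Poly_Mapping.lookup m v = 0")
  case True
  have "m \<noteq> Poly_Mapping.single v 1 + m'" for m'
  proof
    assume "m = Poly_Mapping.single v 1 + m'"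
    then have "Poly_Mapping.lookup m v = 1 + Poly_Mapping.lookup m' v"
      by (simp add: lookup_add)
    with True show False by simp
  qed
  then have "Poly_Mapping.lookup (Var v * P) m = 0"
    unfolding Var_def by (rule lookup_single_times_0)
  then show ?thesis using True by (simp add: divided_coeff_def)
next
  case False
  define m' where "m' = m - Poly_Mapping.single v 1"
  have m: "m = m' + Poly_Mapping.single v 1"
    using single_1_add_diff[OF False] by (simp add: m'_def add.commute)
  have "Poly_Mapping.lookup (Var v * P) m = Poly_Mapping.lookup P m'"
    using lookup_single_times[of "Poly_Mapping.single v 1" 1 P m']
    by (simp add: Var_def m add.commute)
  then show ?thesis
    unfolding m'_def[symmetric] divided_coeff_def
    by (simp add: m mfact_add_single[of m' v, simplified] lookup_add)
qed

lemma divided_coeff_pderiv: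
  "divided_coeff (pderiv_var v P) m = divided_coeff P (m + Poly_Mapping.single v 1)"
proof -
  let ?m = "m + Poly_Mapping.single v 1"
  have "Poly_Mapping.lookup (pderiv_var v P) m =
    (\<Sum>m' \<in> Poly_Mapping.keys P. if m' = ?m then of_nat (Suc (Poly_Mapping.lookup m v)) * Poly_Mapping.lookup P ?m else 0)"
    unfolding pderiv_var_def lookup_sum
  proof (rule sum.cong[OF refl])
    fix m' assume "m' \<in> Poly_Mapping.keys P"
    show "Poly_Mapping.lookup (Poly_Mapping.single (m' - Poly_Mapping.single v 1)
          (of_nat (Poly_Mapping.lookup m' v) * Poly_Mapping.lookup P m')) m =
      (if m' = ?m then of_nat (Suc (Poly_Mapping.lookup m v)) * Poly_Mapping.lookup P ?m else 0)"
    \<comment> \<open>A monomial without \<open>v\<close> is left unchanged by the truncated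
      subtraction and could collide with \<open>m\<close>; its coefficient in the derivative is
      0.\<close>
    proof (cases "Poly_Mapping.lookup m' v = 0")
      case True
      then have "m' \<noteq> ?m" by (auto simp: lookup_add)
      with True show ?thesis by simp
    next
      case False
      from single_1_add_diff[OF this]
      have "m' - Poly_Mapping.single v 1 = m \<longleftrightarrow> m' = ?m"
        by (metis add.commute add_diff_cancel_left')
      then show ?thesis by (auto simp: lookup_single lookup_add)
    qed
  qed
  also have "\<dots> = of_nat (Suc (Poly_Mapping.lookup m v)) * Poly_Mapping.lookup P ?m"
    by (simp add: sum.delta' in_keys_iff)
  finally show ?thesis
    by (simp add: divided_coeff_def mfact_add_single[of m v, simplified] algebra_simps)
qed

lemma divided_coeff_pderiv_pow:
  "divided_coeff ((pderiv_var v ^^ a) P) m = divided_coeff P (m + Poly_Mapping.single v a)"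
proof (induction a arbitrary: m)
  case 0
  then show ?case by simp
next
  case (Suc a)
  then show ?case
    by (simp add: divided_coeff_pderiv add.assoc flip: single_add)
qed

lemma Var_power: "Var v ^ k = Poly_Mapping.single (Poly_Mapping.single v k) 1"
proof (induction k)
  case 0
  then show ?case by simp
next
  case (Suc k)
  then show ?case by (simp add: Var_def mult_single flip: single_add)
qed

lemma prod_single:
  "(\<Prod>i\<in>S. Poly_Mapping.single (f i) (g i)) =
    Poly_Mapping.single (\<Sum>i\<in>S. f i :: monom) (\<Prod>i\<in>S. g i :: rat)"
  by (induction S rule: infinite_finite_induct) (auto simp: mult_single)

section \<open>The symmetric group acting on monomials and coefficients\<close>

lemma perm_act_eq_sum:
  "perm_act \<sigma> P =
    (\<Sum>m\<in>Poly_Mapping.keys P. Poly_Mapping.single (permute_monom \<sigma> m) (Poly_Mapping.lookup P m))"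
  by (simp add: perm_act_def subst_def Var_power prod_single Const_def mult_single permute_monom_def)

lemma inj_perm_var: "inj \<sigma> \<Longrightarrow> inj (perm_var \<sigma>)"
proof (rule injI)
  fix v w assume "inj \<sigma>" "perm_var \<sigma> v = perm_var \<sigma> w"
  then show "v = w" by (cases v; cases w) (auto dest: injD)
qed

lemma lookup_permute_monom:
  assumes "inj \<sigma>"
  shows "Poly_Mapping.lookup (permute_monom \<sigma> m) (perm_var \<sigma> v) = Poly_Mapping.lookup m v"
proof -
  have "Poly_Mapping.lookup (permute_monom \<sigma> m) (perm_var \<sigma> v) =
    (\<Sum>w\<in>Poly_Mapping.keys m. if w = v then Poly_Mapping.lookup m w else 0)"
    unfolding permute_monom_def lookup_sum
    by (intro sum.cong) (auto simp: lookup_single when_def dest: injD[OF inj_perm_var[OF assms]])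
  then show ?thesis by (simp add: sum.delta in_keys_iff)
qed

lemma lookup_permute_monom_X [simp]:
  "inj \<sigma> \<Longrightarrow> Poly_Mapping.lookup (permute_monom \<sigma> m) (X (\<sigma> i)) = Poly_Mapping.lookup m (X i)"
  using lookup_permute_monom[of \<sigma> m "X i"] by simp

lemma lookup_permute_monom_Y [simp]:
  "inj \<sigma> \<Longrightarrow> Poly_Mapping.lookup (permute_monom \<sigma> m) (Y (\<sigma> i)) = Poly_Mapping.lookup m (Y i)"
  using lookup_permute_monom[of \<sigma> m "Y i"] by simp

lemma surj_perm_var: "surj \<sigma> \<Longrightarrow> \<exists>w. v = perm_var \<sigma> w"
proof (cases v)
  case (X i)
  assume "surj \<sigma>"
  then obtain j where "i = \<sigma> j" by (auto simp: surj_def)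
  then show ?thesis using X by (intro exI[of _ "X j"]) simp
next
  case (Y i)
  assume "surj \<sigma>"
  then obtain j where "i = \<sigma> j" by (auto simp: surj_def)
  then show ?thesis using Y by (intro exI[of _ "Y j"]) simp
qed

text \<open>Every variable is the image of a variable under a bijection, so testing exponents at
  \<open>\<sigma> i\<close> suffices and the inverse permutation never has to be mentioned.\<close>

lemma permute_monom_eqI:
  assumes "bij \<sigma>"
    and "\<And>i. Poly_Mapping.lookup m' (X (\<sigma> i)) = Poly_Mapping.lookup m (X i)"
    and "\<And>i. Poly_Mapping.lookup m' (Y (\<sigma> i)) = Poly_Mapping.lookup m (Y i)"
  shows "permute_monom \<sigma> m = m'"
proof (rule poly_mapping_eqI)
  fix v
  from assms(1) obtain w where v: "v = perm_var \<sigma> w"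
    using surj_perm_var bij_is_surj by blast
  show "Poly_Mapping.lookup (permute_monom \<sigma> m) v = Poly_Mapping.lookup m' v"
    unfolding v using assms(2,3) bij_is_inj[OF assms(1)]
    by (cases w) (simp_all)
qed

lemma permute_monom_add:
  "bij \<sigma> \<Longrightarrow> permute_monom \<sigma> (m + m') = permute_monom \<sigma> m + permute_monom \<sigma> m'"
  by (rule permute_monom_eqI) (simp_all add: lookup_add bij_is_inj)

lemma permute_monom_single:
  "permute_monom \<sigma> (Poly_Mapping.single v a) = Poly_Mapping.single (perm_var \<sigma> v) a"
  by (cases "a = 0") (simp_all add: permute_monom_def)

lemma permute_monom_inject:
  assumes "bij \<sigma>"
  shows "permute_monom \<sigma> m = permute_monom \<sigma> m' \<longleftrightarrow> m = m'"
proof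
  assume "permute_monom \<sigma> m = permute_monom \<sigma> m'"
  then have "Poly_Mapping.lookup m v = Poly_Mapping.lookup m' v" for v
    using lookup_permute_monom[OF bij_is_inj[OF assms], of m v]
      lookup_permute_monom[OF bij_is_inj[OF assms], of m' v] by simp
  then show "m = m'" by (rule poly_mapping_eqI)
qed simp

lemma surj_permute_monom:
  assumes "bij \<sigma>"
  obtains m' where "m = permute_monom \<sigma> m'"
proof
  let ?m = "permute_monom (inv_into UNIV \<sigma>) m"
  have inj: "inj (inv_into UNIV \<sigma>)" using assms by (simp add: bij_imp_bij_inv bij_is_inj)
  have i: "inv_into UNIV \<sigma> (\<sigma> i) = i" for i using assms by (simp add: bij_is_inj)
  show "m = permute_monom \<sigma> ?m"
    using lookup_permute_monom_X[OF inj, of m "\<sigma> _"] lookup_permute_monom_Y[OF inj, of m "\<sigma> _"]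
    by (intro permute_monom_eqI[symmetric, OF assms]) (simp_all add: i)
qed

lemma keys_permute_monom:
  assumes "bij \<sigma>"
  shows "Poly_Mapping.keys (permute_monom \<sigma> m) = perm_var \<sigma> ` Poly_Mapping.keys m"
proof -
  have "v \<in> Poly_Mapping.keys (permute_monom \<sigma> m) \<longleftrightarrow> v \<in> perm_var \<sigma> ` Poly_Mapping.keys m" for v
  proof -
    obtain w where v: "v = perm_var \<sigma> w"
      using surj_perm_var bij_is_surj[OF assms] by blast
    show ?thesis unfolding v
      by (simp add: in_keys_iff lookup_permute_monom bij_is_inj[OF assms]
          inj_image_mem_iff[OF inj_perm_var[OF bij_is_inj[OF assms]]])
  qed
  then show ?thesis by blast
qed

lemma mfact_permute_monom:
  assumes "bij \<sigma>"
  shows "mfact (permute_monom \<sigma> m) = mfact m"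
proof -
  have "inj_on (perm_var \<sigma>) (Poly_Mapping.keys m)"
    using inj_perm_var[OF bij_is_inj[OF assms]] by (rule inj_on_subset) simp
  then show ?thesis
    by (simp add: mfact_def keys_permute_monom[OF assms] prod.reindex lookup_permute_monom bij_is_inj[OF assms])
qed

lemma divided_coeff_perm_act:
  assumes "bij \<sigma>"
  shows "divided_coeff (perm_act \<sigma> P) (permute_monom \<sigma> m) = divided_coeff P m"
proof -
  have "Poly_Mapping.lookup (perm_act \<sigma> P) (permute_monom \<sigma> m) =
    (\<Sum>m'\<in>Poly_Mapping.keys P. if m' = m then Poly_Mapping.lookup P m' else 0)"
    unfolding perm_act_eq_sum lookup_sum
    by (intro sum.cong) (auto simp: lookup_single when_def permute_monom_inject[OF assms])
  then show ?thesis
    by (simp add: divided_coeff_def mfact_permute_monom[OF assms] sum.delta in_keys_iff)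
qed

text \<open>Formulated for arbitrary functions on monomials, so that it also applies to sums of
  shifted coefficients as in \<open>alternating_power_sum\<close>.\<close>

definition alternating_coeffs :: "nat \<Rightarrow> (monom \<Rightarrow> rat) \<Rightarrow> bool"
  where "alternating_coeffs n C \<longleftrightarrow>
    (\<forall>\<sigma> m. \<sigma> permutes {1..n} \<longrightarrow> C (permute_monom \<sigma> m) = of_int (sign \<sigma>) * C m)"

text \<open>Permuting variables preserves \<open>mfact\<close>, so the normalisation is harmless.
  The action carries the coefficient at \<open>m\<close> to the permuted monomial; since a sign is
  its own inverse, it may stand on either side of the equation.\<close>

lemma alternating_iff: "alternating n P \<longleftrightarrow> alternating_coeffs n (divided_coeff P)"
proof -
  have "perm_act \<sigma> P = scale (of_int (sign \<sigma>)) P \<longleftrightarrow>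
      (\<forall>m. divided_coeff P (permute_monom \<sigma> m) = of_int (sign \<sigma>) * divided_coeff P m)"
    if "\<sigma> permutes {1..n}" for \<sigma>
  proof -
    have bij: "bij \<sigma>" using that by (rule permutes_bij)
    have "perm_act \<sigma> P = scale (of_int (sign \<sigma>)) P \<longleftrightarrow>
      (\<forall>m. divided_coeff (perm_act \<sigma> P) m = of_int (sign \<sigma>) * divided_coeff P m)"
      by (simp flip: divided_coeff_inject divided_coeff_scale add: fun_eq_iff)
    also have "\<dots> \<longleftrightarrow> (\<forall>m. divided_coeff (perm_act \<sigma> P) (permute_monom \<sigma> m) =
        of_int (sign \<sigma>) * divided_coeff P (permute_monom \<sigma> m))"
      (is "(\<forall>m. ?A m) \<longleftrightarrow> (\<forall>m. ?A (permute_monom \<sigma> m))")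
    proof (intro iffI allI)
      fix m assume *: "\<forall>m. ?A (permute_monom \<sigma> m)"
      obtain m' where "m = permute_monom \<sigma> m'" using surj_permute_monom[OF bij] .
      then show "?A m" using * by blast
    qed blast
    also have "\<dots> \<longleftrightarrow> (\<forall>m. divided_coeff P m = of_int (sign \<sigma>) * divided_coeff P (permute_monom \<sigma> m))"
      by (simp only: divided_coeff_perm_act[OF bij])
    also have "\<dots> \<longleftrightarrow> (\<forall>m. divided_coeff P (permute_monom \<sigma> m) = of_int (sign \<sigma>) * divided_coeff P m)"
    proof (rule iff_allI)
      have s: "of_int (sign \<sigma>) * (of_int (sign \<sigma>) * x) = (x::rat)" for x
        by (simp add: sign_def)
      show "divided_coeff P m = of_int (sign \<sigma>) * divided_coeff P (permute_monom \<sigma> m) \<longleftrightarrow>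
          divided_coeff P (permute_monom \<sigma> m) = of_int (sign \<sigma>) * divided_coeff P m" for m
        by (metis s)
    qed
    finally show ?thesis .
  qed
  then show ?thesis by (auto simp: alternating_def alternating_coeffs_def)
qed

lemma diag_harmonic_iff:
  "diag_harmonic n P \<longleftrightarrow>
    (\<forall>a b m. a + b > 0 \<longrightarrow> (\<Sum>i = 1..n. divided_coeff P (m + x_pow i a + y_pow i b)) = 0)"
proof -
  have "(\<Sum>i = 1..n. (pderiv_var (X i) ^^ a) ((pderiv_var (Y i) ^^ b) P)) = 0 \<longleftrightarrow>
    (\<forall>m. (\<Sum>i = 1..n. divided_coeff P (m + x_pow i a + y_pow i b)) = 0)" for a b
    unfolding divided_coeff_inject[symmetric] fun_eq_iff
    by (simp add: divided_coeff_sum divided_coeff_pderiv_pow)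
  then show ?thesis by (auto simp: diag_harmonic_def)
qed

subsection \<open>Coefficients annihilated by power sums\<close>

lemma poly_mapping_sum_single:
  "(\<Sum>m\<in>Poly_Mapping.keys q. Poly_Mapping.single m (Poly_Mapping.lookup q m)) = q"
  by (rule poly_mapping_eqI) (simp add: lookup_sum lookup_single when_def in_keys_iff sum.delta)

definition power_sums_kill :: "nat \<Rightarrow> (monom \<Rightarrow> rat) \<Rightarrow> bool"
  where "power_sums_kill n C \<longleftrightarrow> (\<forall>a m. a \<ge> 1 \<longrightarrow> (\<Sum>i = 1..n. C (m + x_pow i a)) = 0)"

text \<open>Extended linearly to polynomials, \<open>C\<close> vanishes on the ideal generated by
  the power sums, which contains the \<open>n\<close>-th power of each variable \<open>X i\<close>
  with \<open>i\<close> in \<open>{1..n}\<close>.\<close>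

lemma power_sums_kill_exponent_bound:
  assumes C: "power_sums_kill n C" and i: "i \<in> {1..n}" and m: "n \<le> Poly_Mapping.lookup m (X i)"
  shows "C m = 0"
proof -
  define \<phi> :: "qpoly \<Rightarrow> rat"
    where "\<phi> q = (\<Sum>m\<in>Poly_Mapping.keys q. Poly_Mapping.lookup q m * C m)" for q
  have \<phi>_add: "\<phi> (p + q) = \<phi> p + \<phi> q" for p q
    unfolding \<phi>_def by (rule setsum_keys_plus_distrib) (simp_all add: algebra_simps)
  have \<phi>_0: "\<phi> 0 = 0" by (simp add: \<phi>_def)
  have \<phi>_sum: "\<phi> (sum f S) = (\<Sum>i\<in>S. \<phi> (f i))" for f and S :: "'b set"
    by (induction S rule: infinite_finite_induct) (auto simp: \<phi>_0 \<phi>_add)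
  have \<phi>_single: "\<phi> (Poly_Mapping.single m c) = c * C m" for m c
    by (cases "c = 0") (simp_all add: \<phi>_def)
  have \<phi>_of_nat: "\<phi> (of_nat k * q) = of_nat k * \<phi> q" for k q
    by (induction k) (simp_all add: \<phi>_0 \<phi>_add algebra_simps)
  \<comment> \<open>The largest ideal inside the kernel of \<open>\<phi>\<close>. It is closed under
    division by positive integers because \<open>\<phi>\<close> has rational values.\<close>
  define I where "I = {p. \<forall>q. \<phi> (p * q) = 0}"
  have "(Var (X i)) ^ card {1..n} \<in> I"
  proof (rule power_card_in_ideal[where z = "\<lambda>i. Var (X i)"])
    fix a :: nat assume "a \<ge> 1"
    have "\<phi> ((\<Sum>i = 1..n. Var (X i) ^ a) * q) = 0" for q
    proof -
      have "(\<Sum>i = 1..n. Var (X i) ^ a) * q = (\<Sum>m\<in>Poly_Mapping.keys q. \<Sum>i = 1..n.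
          Var (X i) ^ a * Poly_Mapping.single m (Poly_Mapping.lookup q m))"
        by (subst (1) poly_mapping_sum_single[of q, symmetric])
          (simp only: sum_product sum.swap[of _ "{1..n}"])
      then have "\<phi> ((\<Sum>i = 1..n. Var (X i) ^ a) * q) =
          (\<Sum>m\<in>Poly_Mapping.keys q. \<Sum>i = 1..n. Poly_Mapping.lookup q m * C (m + x_pow i a))"
        by (simp add: \<phi>_sum Var_power mult_single \<phi>_single add.commute)
      also have "\<dots> = 0"
        using C \<open>a \<ge> 1\<close> by (simp add: power_sums_kill_def flip: sum_distrib_left)
      finally show ?thesis .
    qed
    then show "(\<Sum>i = 1..n. Var (X i) ^ a) \<in> I" by (simp add: I_def)
  next
    fix k x assume "of_nat (Suc k) * x \<in> I"
    then have "of_nat (Suc k) * \<phi> (x * q) = 0" for q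
      by (simp add: I_def mult.assoc \<phi>_of_nat del: of_nat_Suc)
    then show "x \<in> I" by (simp add: I_def del: of_nat_Suc)
  qed (use i in \<open>auto simp: I_def \<phi>_0 \<phi>_add algebra_simps\<close>)
  then have "\<phi> (Var (X i) ^ n * Poly_Mapping.single (m - x_pow i n) 1) = 0"
    by (simp add: I_def)
  moreover have "x_pow i n + (m - x_pow i n) = m"
    using m by (intro poly_mapping_eqI) (auto simp: lookup_add lookup_minus lookup_single when_def)
  ultimately show ?thesis by (simp add: Var_power mult_single \<phi>_single)
qed

text \<open>The transposition of \<open>i\<close> and \<open>j\<close> fixes \<open>m\<close> but
  has sign -1, so \<open>C m = - C m\<close>.\<close>

lemma alternating_coeffs_eq_0:
  assumes "alternating_coeffs n C" "i \<in> {1..n}" "j \<in> {1..n}" "i \<noteq> j"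
    and "Poly_Mapping.lookup m (X i) = Poly_Mapping.lookup m (X j)"
    and "Poly_Mapping.lookup m (Y i) = Poly_Mapping.lookup m (Y j)"
  shows "C m = 0"
proof -
  let ?t = "Transposition.transpose i j"
  have "permute_monom ?t m = m"
    by (rule permute_monom_eqI) (use assms in \<open>auto simp: Transposition.transpose_def\<close>)
  moreover have "?t permutes {1..n}" using assms by (intro permutes_swap_id) auto
  ultimately have "C m = of_int (sign ?t) * C m"
    using assms(1) unfolding alternating_coeffs_def by metis
  then show ?thesis using \<open>i \<noteq> j\<close> by (simp add: sign_swap_id)
qed

section \<open>Normal forms for monomials of y-degree 1\<close>

text \<open>For \<open>v < n\<close>, the function \<open>gap_exp v\<close> lists \<open>{0..<n} - {v}\<close> increasingly along \<open>1, \<dots>, n - 1\<close>.\<close>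

definition gap_exp :: "nat \<Rightarrow> nat \<Rightarrow> nat"
  where "gap_exp v j = (if j \<le> v then j - 1 else j)"

text \<open>The value of \<open>C\<close> here is the quantity \<open>t v r\<close> of the overview;
  \<open>r\<close> is free and may coincide with one of the other exponents.\<close>

definition gap_monom :: "nat \<Rightarrow> nat \<Rightarrow> nat \<Rightarrow> monom"
  where "gap_monom n v r = y_pow n 1 + x_pow n r + (\<Sum>j = 1..<n. x_pow j (gap_exp v j))"

lemma bij_betw_gap_exp:
  assumes "v < n"
  shows "bij_betw (gap_exp v) {1..<n} ({..<n} - {v})"
proof -
  have inj: "inj_on (gap_exp v) {1..<n}"
    by (auto simp: inj_on_def gap_exp_def split: if_splits)
  moreover have "gap_exp v ` {1..<n} = {..<n} - {v}"
  proof (rule card_subset_eq)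
    show "gap_exp v ` {1..<n} \<subseteq> {..<n} - {v}"
      using assms by (auto simp: gap_exp_def)
    show "card (gap_exp v ` {1..<n}) = card ({..<n} - {v})"
      using assms card_image[OF inj] by simp
  qed simp
  ultimately show ?thesis by (simp add: bij_betw_def)
qed

lemma lookup_gap_monom_X:
  "Poly_Mapping.lookup (gap_monom n v r) (X i) =
    (if i = n then r else if i \<in> {1..<n} then gap_exp v i else 0)"
  by (auto simp: gap_monom_def lookup_add lookup_sum lookup_single when_def sum.delta)

lemma lookup_gap_monom_Y:
  "Poly_Mapping.lookup (gap_monom n v r) (Y i) = (if i = n then 1 else 0)"
  by (auto simp: gap_monom_def lookup_add lookup_sum lookup_single when_def)

lemma monom_eqI:
  assumes "\<And>i. Poly_Mapping.lookup m (X i) = Poly_Mapping.lookup m' (X i)"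
    and "\<And>i. Poly_Mapping.lookup m (Y i) = Poly_Mapping.lookup m' (Y i)"
  shows "m = (m'::monom)"
proof (rule poly_mapping_eqI)
  fix v show "Poly_Mapping.lookup m v = Poly_Mapping.lookup m' v"
    by (cases v) (simp_all add: assms)
qed

text \<open>The exponents at \<open>1, ..., n - 1\<close> run through \<open>{0..<n} - {v}\<close>.
  Keeping \<open>v\<close> on the left avoids truncated subtraction.\<close>

lemma xdeg_gap_monom:
  assumes "v < n"
  shows "xdeg n (gap_monom n v r) + v = r + n * (n - 1) div 2"
proof -
  have "{1..n} = insert n {1..<n}" using assms by auto
  then have "xdeg n (gap_monom n v r) = r + (\<Sum>i = 1..<n. gap_exp v i)"
    by (simp add: xdeg_def lookup_gap_monom_X)
  also have "(\<Sum>i = 1..<n. gap_exp v i) = (\<Sum>j\<in>{..<n} - {v}. j)"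
    by (rule sum.reindex_bij_betw[OF bij_betw_gap_exp[OF assms]])
  finally have "xdeg n (gap_monom n v r) + v = r + (\<Sum>j<n. j)"
    using assms by (simp add: sum.remove[of "{..<n}" v])
  then show ?thesis
    by (simp add: Sum_Ico_nat lessThan_atLeast0)
qed

text \<open>Index \<open>v\<close> carries exponent \<open>v - 1\<close>, the one just below the
  gap; raising it fills the gap and opens a new one at \<open>v - 1\<close>.\<close>

lemma gap_monom_shift:
  assumes "1 \<le> v" "v < n"
  shows "gap_monom n v r + x_pow v 1 = gap_monom n (v - 1) r"
  by (rule monom_eqI)
    (use assms in \<open>auto simp: lookup_add lookup_gap_monom_X lookup_gap_monom_Y lookup_single when_def gap_exp_def\<close>)

lemma gap_monom_Suc: "gap_monom n v r + x_pow n 1 = gap_monom n v (Suc r)"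
  by (rule monom_eqI) (auto simp: lookup_add lookup_gap_monom_X lookup_gap_monom_Y lookup_single when_def)

text \<open>Away from the gap, raising the exponent at \<open>i\<close> makes it equal to the one at
  \<open>i + 1\<close>, and alternation gives 0. For \<open>i = n - 1\<close> there is no such
  neighbour, but the exponent reaches \<open>n\<close>.\<close>

lemma coeff_gap_monom_add_eq_0:
  assumes C: "power_sums_kill n C" "alternating_coeffs n C" and "v < n" "i \<in> {1..<n}" "i \<noteq> v"
  shows "C (gap_monom n v r + x_pow i 1) = 0"
proof (cases "Suc i = n")
  case True
  then have "n \<le> Poly_Mapping.lookup (gap_monom n v r + x_pow i 1) (X i)"
    using assms by (auto simp: lookup_add lookup_gap_monom_X gap_exp_def)
  then show ?thesis
    using assms by (intro power_sums_kill_exponent_bound[OF C(1)]) auto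
next
  case False
  with assms show ?thesis
    by (intro alternating_coeffs_eq_0[OF C(2), of i "Suc i"])
      (auto simp: lookup_add lookup_gap_monom_X lookup_gap_monom_Y lookup_single gap_exp_def)
qed

text \<open>In the relation for the first power sum at \<open>gap_monom n v r\<close>, only the
  terms \<open>i = n\<close> and \<open>i = v\<close> can survive; for \<open>v = 0\<close> the
  latter is absent.\<close>

lemma coeff_gap_monom_relation:
  assumes C: "power_sums_kill n C" "alternating_coeffs n C" and v: "v < n"
  shows "C (gap_monom n v (Suc r)) = (if v = 0 then 0 else - C (gap_monom n (v - 1) r))"
proof -
  let ?f = "\<lambda>i. C (gap_monom n v r + x_pow i 1)"
  have "{1..n} = insert n {1..<n}" using v by auto
  moreover have "(\<Sum>i = 1..n. ?f i) = 0"
    using C(1) by (simp add: power_sums_kill_def)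
  ultimately have "?f n + (\<Sum>i = 1..<n. ?f i) = 0" by simp
  moreover have "(\<Sum>i = 1..<n. ?f i) = (\<Sum>i = 1..<n. if i = v then ?f v else 0)"
    using coeff_gap_monom_add_eq_0[OF C v] by (intro sum.cong) auto
  moreover have "\<dots> = (if v = 0 then 0 else C (gap_monom n (v - 1) r))"
    using v gap_monom_shift[of v n r] by (simp add: sum.delta)
  ultimately show ?thesis
    by (simp add: gap_monom_Suc[simplified] split: if_splits)
qed

lemma coeff_gap_monom_le:
  assumes C: "power_sums_kill n C" "alternating_coeffs n C" and "v < n" "r \<le> v"
  shows "C (gap_monom n v r) = (-1) ^ r * C (gap_monom n (v - r) 0)"
  using assms(3,4)
proof (induction r arbitrary: v)
  case 0
  then show ?case by simp
next
  case (Suc r)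
  then show ?case
    using coeff_gap_monom_relation[OF C, of v r] Suc.IH[of "v - 1"] by simp
qed

text \<open>Each use of the relation lowers \<open>v\<close> and \<open>r\<close> together. With
  \<open>v < r\<close> the gap reaches 0 while \<open>r\<close> is still positive, where the
  relation gives 0.\<close>

lemma coeff_gap_monom_gt:
  assumes C: "power_sums_kill n C" "alternating_coeffs n C" and "v < n" "v < r"
  shows "C (gap_monom n v r) = 0"
  using assms(3,4)
proof (induction v arbitrary: r)
  case 0
  then show ?case
    using coeff_gap_monom_relation[OF C, of 0 "r - 1"] by simp
next
  case (Suc v)
  then show ?case
    using coeff_gap_monom_relation[OF C, of "Suc v" "r - 1"] Suc.IH[of "r - 1"] by simp
qed

text \<open>Exactly one index carries a \<open>y\<close>. The other indices agree in their
  y-exponents, so alternation forces their x-exponents to be distinct; they are also below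
  \<open>n\<close>.\<close>

lemma permute_to_gap_monom:
  assumes C: "power_sums_kill n C" "alternating_coeffs n C" and "C m \<noteq> 0"
    and keys: "Poly_Mapping.keys m \<subseteq> X ` {1..n} \<union> Y ` {1..n}" and "ydeg n m = 1"
  obtains \<sigma> v r where "\<sigma> permutes {1..n}" "v < n" "permute_monom \<sigma> m = gap_monom n v r"
proof -
  define l where "l j = Poly_Mapping.lookup m (X j)" for j
  have l0: "l j = 0" "Poly_Mapping.lookup m (Y j) = 0" if "j \<notin> {1..n}" for j
    using that keys by (auto simp: l_def in_keys_iff)
  from \<open>ydeg n m = 1\<close> obtain i where i: "i \<in> {1..n}" "Poly_Mapping.lookup m (Y i) = 1"
    and yi: "\<And>j. j \<in> {1..n} \<Longrightarrow> j \<noteq> i \<Longrightarrow> Poly_Mapping.lookup m (Y j) = 0"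
    using sum_eq_1_iff[of "{1..n}" "\<lambda>j. Poly_Mapping.lookup m (Y j)"]
    unfolding ydeg_def by (metis finite_atLeastAtMost)
  let ?S = "{1..n} - {i}"
  have inj: "inj_on l ?S"
  proof (rule inj_onI, rule ccontr)
    fix j j' assume "j \<in> ?S" "j' \<in> ?S" "l j = l j'" "j \<noteq> j'"
    then have "C m = 0"
      by (intro alternating_coeffs_eq_0[OF C(2), of j j']) (auto simp: l_def yi)
    with \<open>C m \<noteq> 0\<close> show False ..
  qed
  have less: "l j < n" if "j \<in> {1..n}" for j
    using power_sums_kill_exponent_bound[OF C(1) that] \<open>C m \<noteq> 0\<close> by (force simp: l_def not_less)
  have sub: "l ` ?S \<subseteq> {..<n}" using less by auto
  \<comment> \<open>There are \<open>n - 1\<close> distinct values among \<open>n\<close>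
    candidates, so exactly one is missing.\<close>
  then have "card ({..<n} - l ` ?S) = 1"
    using i card_image[OF inj] by (simp add: card_Diff_subset)
  then obtain v where v: "{..<n} - l ` ?S = {v}" by (auto simp: card_1_singleton_iff)
  then have vn: "v < n" by auto
  have img: "l ` ?S = {..<n} - {v}" using v sub by blast
  note bij = bij_betw_gap_exp[OF vn]
  \<comment> \<open>The index carrying the \<open>y\<close> goes to \<open>n\<close>; any other
    \<open>j\<close> goes to the position where \<open>gap_exp v\<close> lists its exponent.\<close>
  define \<sigma> where "\<sigma> j = (if j = i then n else if j \<in> {1..n} then inv_into {1..<n} (gap_exp v) (l j) else j)" for j
  have \<sigma>i: "\<sigma> i = n" by (simp add: \<sigma>_def)
  have \<sigma>out: "\<sigma> j = j" if "j \<notin> {1..n}" for j using that i by (auto simp: \<sigma>_def)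
  have \<sigma>S: "\<sigma> j \<in> {1..<n}" "gap_exp v (\<sigma> j) = l j" if "j \<in> ?S" for j
  proof -
    have "l j \<in> gap_exp v ` {1..<n}" using that img bij by (auto simp: bij_betw_def)
    then show "\<sigma> j \<in> {1..<n}" "gap_exp v (\<sigma> j) = l j"
      using that inv_into_into[of "l j" "gap_exp v" "{1..<n}"] f_inv_into_f[of "l j" "gap_exp v" "{1..<n}"]
      by (simp_all add: \<sigma>_def)
  qed
  have "inj_on \<sigma> {1..n}"
  proof (rule inj_onI)
    fix j j' assume j: "j \<in> {1..n}" "j' \<in> {1..n}" "\<sigma> j = \<sigma> j'"
    show "j = j'"
    proof (cases "j = i \<or> j' = i")
      case True
      then show ?thesis using j \<sigma>i \<sigma>S(1)[of j] \<sigma>S(1)[of j']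
        by (cases "j = i"; cases "j' = i") auto
    next
      case False
      then have "l j = l j'" using j \<sigma>S(2)[of j] \<sigma>S(2)[of j'] by auto
      then show ?thesis using inj False j by (auto dest: inj_onD)
    qed
  qed
  moreover have "\<sigma> ` {1..n} \<subseteq> {1..n}"
  proof
    fix x assume "x \<in> \<sigma> ` {1..n}"
    then obtain j where "j \<in> {1..n}" "x = \<sigma> j" by blast
    then show "x \<in> {1..n}" using \<sigma>i \<sigma>S(1)[of j] i by (cases "j = i") auto
  qed
  ultimately have "bij_betw \<sigma> {1..n} {1..n}"
    by (simp add: bij_betw_def endo_inj_surj)
  then have perm: "\<sigma> permutes {1..n}" using \<sigma>out by (intro bij_imp_permutes) auto
  have "permute_monom \<sigma> m = gap_monom n v (l i)"
  proof (rule permute_monom_eqI[OF permutes_bij[OF perm]])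
    fix j
    show "Poly_Mapping.lookup (gap_monom n v (l i)) (X (\<sigma> j)) = Poly_Mapping.lookup m (X j)"
      using \<sigma>S[of j] \<sigma>out[of j] l0[of j] i
      by (cases "j = i"; cases "j \<in> {1..n}") (auto simp: lookup_gap_monom_X \<sigma>i l_def)
    show "Poly_Mapping.lookup (gap_monom n v (l i)) (Y (\<sigma> j)) = Poly_Mapping.lookup m (Y j)"
      using \<sigma>S[of j] \<sigma>out[of j] l0[of j] i yi[of j]
      by (cases "j = i"; cases "j \<in> {1..n}") (auto simp: lookup_gap_monom_Y \<sigma>i)
  qed
  with perm vn show ?thesis by (rule that)
qed

lemma xdeg_permute_monom: "\<sigma> permutes {1..n} \<Longrightarrow> xdeg n (permute_monom \<sigma> m) = xdeg n m"
  unfolding xdeg_def by (subst sum.permute[of \<sigma>]) (auto simp: permutes_inj)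

text \<open>The conditions defining \<open>A_bideg n k 1\<close>, without the harmonicity conditions involving \<open>\<partial>\<^sub>y\<close>.\<close>

definition x_harmonic_coeffs :: "nat \<Rightarrow> int \<Rightarrow> (monom \<Rightarrow> rat) \<Rightarrow> bool"
  where "x_harmonic_coeffs n k C \<longleftrightarrow>
    power_sums_kill n C \<and> alternating_coeffs n C \<and>
    (\<forall>m. C m \<noteq> 0 \<longrightarrow> Poly_Mapping.keys m \<subseteq> X ` {1..n} \<union> Y ` {1..n} \<and>
      int (xdeg n m) = int (n * (n - 1) div 2) - k \<and> ydeg n m = 1)"

text \<open>The degree forces \<open>r = v - k\<close> in the normal form of a monomial of the
  support, and the recursion then leads back to \<open>gap_monom n (nat k) 0\<close>. For
  \<open>k\<close> outside \<open>0, ..., n - 1\<close> the assumption \<open>0\<close> is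
  vacuous.\<close>

lemma x_harmonic_coeffs_eq_0:
  assumes C: "x_harmonic_coeffs n k C"
    and 0: "0 \<le> k \<Longrightarrow> k < int n \<Longrightarrow> C (gap_monom n (nat k) 0) = 0"
  shows "C m = 0"
proof (rule ccontr)
  assume m: "C m \<noteq> 0"
  from C have C': "power_sums_kill n C" "alternating_coeffs n C"
    and keys: "Poly_Mapping.keys m \<subseteq> X ` {1..n} \<union> Y ` {1..n}"
    and xdeg: "int (xdeg n m) = int (n * (n - 1) div 2) - k" and ydeg: "ydeg n m = 1"
    using m by (auto simp: x_harmonic_coeffs_def)
  obtain \<sigma> v r where \<sigma>: "\<sigma> permutes {1..n}" and v: "v < n" and gap: "permute_monom \<sigma> m = gap_monom n v r"
    using permute_to_gap_monom[OF C' m keys ydeg] .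
  have "C (gap_monom n v r) = of_int (sign \<sigma>) * C m"
    using C'(2) \<sigma> by (simp add: alternating_coeffs_def flip: gap)
  with m have nz: "C (gap_monom n v r) \<noteq> 0" by (simp add: sign_def)
  have "xdeg n m + v = r + n * (n - 1) div 2"
    using xdeg_gap_monom[OF v, of r] xdeg_permute_monom[OF \<sigma>, of m] gap by metis
  with xdeg have k: "k = int v - int r" by linarith
  have "r \<le> v" using coeff_gap_monom_gt[OF C' v] nz not_le by blast
  with k have "v - r = nat k" "0 \<le> k" "k < int n" using v by auto
  then show False
    using coeff_gap_monom_le[OF C' v \<open>r \<le> v\<close>] nz 0 by simp
qed

subsection \<open>The Vandermonde determinant\<close>

text \<open>The monomial contributed by \<open>p\<close> to the Leibniz expansion of
  \<open>Delta n\<close>; rows count from 0, variables from 1.\<close>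

definition Delta_monom :: "nat \<Rightarrow> (nat \<Rightarrow> nat) \<Rightarrow> monom"
  where "Delta_monom n p = (\<Sum>i = 0..<n. x_pow (Suc i) (n - Suc (p i)))"

abbreviation Delta_coeff :: "nat \<Rightarrow> monom \<Rightarrow> rat"
  where "Delta_coeff n \<equiv> divided_coeff (Delta n)"

lemma lookup_Delta_monom_Y [simp]: "Poly_Mapping.lookup (Delta_monom n p) (Y j) = 0"
  by (simp add: Delta_monom_def lookup_sum lookup_single)

lemma lookup_Delta_monom_X_0 [simp]: "Poly_Mapping.lookup (Delta_monom n p) (X 0) = 0"
  by (simp add: Delta_monom_def lookup_sum lookup_single)

lemma lookup_Delta_monom_X_Suc [simp]:
  "Poly_Mapping.lookup (Delta_monom n p) (X (Suc i)) = (if i < n then n - Suc (p i) else 0)"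
  by (simp add: Delta_monom_def lookup_sum lookup_single when_def sum.delta)

lemma mfact_Delta_monom: "mfact (Delta_monom n p) = (\<Prod>i = 0..<n. fact (n - Suc (p i)))"
proof -
  have "Poly_Mapping.keys (Delta_monom n p) \<subseteq> (\<lambda>i. X (Suc i)) ` {0..<n}"
  proof
    fix v assume v: "v \<in> Poly_Mapping.keys (Delta_monom n p)"
    show "v \<in> (\<lambda>i. X (Suc i)) ` {0..<n}"
    proof (cases v)
      case (X j)
      with v show ?thesis by (cases j) (auto simp: in_keys_iff split: if_splits)
    next
      case (Y j)
      with v show ?thesis by (simp add: in_keys_iff)
    qed
  qed
  then have "mfact (Delta_monom n p) =
      (\<Prod>v\<in>(\<lambda>i. X (Suc i)) ` {0..<n}. fact (Poly_Mapping.lookup (Delta_monom n p) v))"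
    by (intro mfact_superset) auto
  also have "\<dots> = (\<Prod>i = 0..<n. fact (n - Suc (p i)))"
    by (subst prod.reindex) (auto simp: inj_on_def)
  finally show ?thesis .
qed

text \<open>The factorials in the denominators of the matrix entries cancel \<open>mfact\<close>,
  leaving only signs.\<close>

lemma Delta_coeff_eq:
  "Delta_coeff n m =
    (\<Sum>p | p permutes {0..<n}. of_int (sign p) * (if m = Delta_monom n p then 1 else 0))"
proof -
  have summand: "of_int (sign p) * (\<Prod>i = 0..<n. scale (1 / fact (n - Suc (p i))) (Var (X (Suc i)) ^ (n - Suc (p i))))
      = scale (of_int (sign p)) (Poly_Mapping.single (Delta_monom n p) (1 / mfact (Delta_monom n p)))" for p
  proof -
    have "(\<Prod>i = 0..<n. scale (1 / fact (n - Suc (p i))) (Var (X (Suc i)) ^ (n - Suc (p i)))) =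
      Poly_Mapping.single (Delta_monom n p) (1 / mfact (Delta_monom n p))"
      by (simp add: scale_def Const_def Var_power mult_single prod_single Delta_monom_def
          mfact_Delta_monom[unfolded Delta_monom_def] prod_dividef)
    then show ?thesis by (simp add: scale_def Const_def)
  qed
  have less: "p i < n" if "p permutes {0..<n}" "i < n" for p i
    using permutes_in_image[OF that(1), of i] that(2) by simp
  have "Delta n = (\<Sum>p | p permutes {0..<n}. of_int (sign p) *
      (\<Prod>i = 0..<n. scale (1 / fact (n - Suc (p i))) (Var (X (Suc i)) ^ (n - Suc (p i)))))"
    unfolding Delta_def Determinant.det_def
    by (auto intro!: sum.cong prod.cong arg_cong2[where f = "(*)"] simp: less)
  then have "Delta n = (\<Sum>p | p permutes {0..<n}. scale (of_int (sign p))
      (Poly_Mapping.single (Delta_monom n p) (1 / mfact (Delta_monom n p))))"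
    by (simp only: summand)
  then show ?thesis
    by (simp add: divided_coeff_sum divided_coeff_scale) (auto simp: divided_coeff_def lookup_single intro!: sum.cong)
qed

text \<open>Translates between permutations of the variable indices \<open>{1..n}\<close> and of the
  matrix indices \<open>{0..<n}\<close>.\<close>

lemma permutes_Suc_shift:
  assumes "\<sigma> permutes {1..n}"
  obtains \<tau> where "\<tau> permutes {0..<n}" "\<And>i. \<sigma> (Suc i) = Suc (\<tau> i)" "sign \<tau> = sign \<sigma>"
proof
  define \<tau> where "\<tau> i = \<sigma> (Suc i) - 1" for i
  have 0: "\<sigma> 0 = 0" using assms by (simp add: permutes_not_in)
  show \<tau>: "\<sigma> (Suc i) = Suc (\<tau> i)" for i
  proof -
    have "\<sigma> (Suc i) \<noteq> \<sigma> 0" using permutes_inj[OF assms] by (auto dest: injD)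
    then show ?thesis by (simp add: \<tau>_def 0)
  qed
  have out: "\<tau> i = i" if "i \<notin> {0..<n}" for i
    using that assms by (simp add: \<tau>_def permutes_not_in)
  have "inj_on \<tau> {0..<n}"
    using permutes_inj[OF assms] \<tau> by (metis injD inj_onI nat.inject)
  moreover have "\<tau> ` {0..<n} \<subseteq> {0..<n}"
  proof
    fix x assume "x \<in> \<tau> ` {0..<n}"
    then obtain i where "i < n" "x = \<tau> i" by auto
    with permutes_in_image[OF assms, of "Suc i"] show "x \<in> {0..<n}" by (simp add: \<tau>)
  qed
  ultimately show perm: "\<tau> permutes {0..<n}"
    using out by (intro bij_imp_permutes) (auto simp: bij_betw_def endo_inj_surj)
  have "map_permutation {0..<n} Suc \<tau> = \<sigma>"
  proof
    fix x
    show "map_permutation {0..<n} Suc \<tau> x = \<sigma> x"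
    proof (cases "x \<in> {1..n}")
      case True
      then obtain i where "x = Suc i" "i \<in> {0..<n}" by (cases x) auto
      then show ?thesis by (simp add: map_permutation_apply \<tau>)
    next
      case False
      then have "x \<notin> Suc ` {0..<n}" by auto
      then show ?thesis using False assms
        by (simp add: map_permutation_def restrict_id_def permutes_not_in del: image_Suc_atLeastLessThan)
    qed
  qed
  then show "sign \<tau> = sign \<sigma>"
    using sign_map_permutation[of Suc "{0..<n}" \<tau>] perm by simp
qed

text \<open>Permuting the rows replaces \<open>p\<close> by \<open>p \<circ> \<tau>\<close> in the
  Leibniz sum; reindexing the sum costs the sign of \<open>\<tau>\<close>.\<close>

lemma alternating_Delta: "alternating_coeffs n (Delta_coeff n)"
  unfolding alternating_coeffs_def
proof (intro allI impI)
  fix \<sigma> m assume \<sigma>: "\<sigma> permutes {1..n}"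
  then obtain \<tau> where \<tau>: "\<tau> permutes {0..<n}" "\<And>i. \<sigma> (Suc i) = Suc (\<tau> i)" "sign \<tau> = sign \<sigma>"
    using permutes_Suc_shift by blast
  have bij: "bij \<sigma>" using \<sigma> by (rule permutes_bij)
  have mon: "Delta_monom n p = permute_monom \<sigma> (Delta_monom n (p \<circ> \<tau>))" for p
  proof (rule permute_monom_eqI[OF bij, symmetric])
    fix i
    show "Poly_Mapping.lookup (Delta_monom n p) (X (\<sigma> i)) =
        Poly_Mapping.lookup (Delta_monom n (p \<circ> \<tau>)) (X i)"
      using \<sigma> permutes_in_image[OF \<tau>(1)] by (cases i) (auto simp: permutes_not_in \<tau>(2))
  qed simp
  have "Delta_coeff n (permute_monom \<sigma> m) =
    (\<Sum>p | p permutes {0..<n}. of_int (sign p) * (if m = Delta_monom n (p \<circ> \<tau>) then 1 else 0))"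
    unfolding Delta_coeff_eq by (subst mon) (simp add: permute_monom_inject[OF bij])
  also have "\<dots> = (\<Sum>p | p permutes {0..<n}. of_int (sign \<sigma>) *
      (of_int (sign (p \<circ> \<tau>)) * (if m = Delta_monom n (p \<circ> \<tau>) then 1 else 0)))"
  proof (rule sum.cong[OF refl])
    fix p assume "p \<in> {p. p permutes {0..<n}}"
    then have "sign (p \<circ> \<tau>) = sign p * sign \<sigma>"
      using \<tau> by (simp add: sign_compose permutes_imp_permutation[of "{0..<n}"])
    then show "of_int (sign p) * (if m = Delta_monom n (p \<circ> \<tau>) then 1 else 0) =
      of_int (sign \<sigma>) * (of_int (sign (p \<circ> \<tau>)) * (if m = Delta_monom n (p \<circ> \<tau>) then 1 else (0::rat)))"
      by (simp add: sign_def)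
  qed
  also have "\<dots> = of_int (sign \<sigma>) * Delta_coeff n m"
    unfolding Delta_coeff_eq sum_distrib_left
    by (rule sum_permutations_compose_right[OF \<tau>(1), symmetric])
  finally show "Delta_coeff n (permute_monom \<sigma> m) = of_int (sign \<sigma>) * Delta_coeff n m" .
qed

lemma Delta_monom_inject:
  assumes "p permutes {0..<n}" "q permutes {0..<n}"
  shows "Delta_monom n p = Delta_monom n q \<longleftrightarrow> p = q"
proof
  assume eq: "Delta_monom n p = Delta_monom n q"
  show "p = q"
  proof
    fix i
    show "p i = q i"
    proof (cases "i < n")
      case True
      then have "p i < n" "q i < n"
        using permutes_in_image[OF assms(1), of i] permutes_in_image[OF assms(2), of i] by auto
      moreover have "n - Suc (p i) = n - Suc (q i)"
        using True lookup_Delta_monom_X_Suc[of n p i] lookup_Delta_monom_X_Suc[of n q i] eq by simp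
      ultimately show ?thesis by linarith
    next
      case False
      with assms show ?thesis by (simp add: permutes_not_in)
    qed
  qed
qed simp

text \<open>Distinct exponents below \<open>n\<close> determine a permutation, and distinct
  permutations give distinct monomials. Hence a single Leibniz term contributes, and no cancellation
  occurs.\<close>

lemma Delta_coeff_nonzero:
  assumes "\<And>i. i \<notin> {1..n} \<Longrightarrow> Poly_Mapping.lookup m (X i) = 0" "\<And>i. Poly_Mapping.lookup m (Y i) = 0"
    and less: "\<And>i. i \<in> {1..n} \<Longrightarrow> Poly_Mapping.lookup m (X i) < n"
    and inj: "inj_on (\<lambda>i. Poly_Mapping.lookup m (X i)) {1..n}"
  shows "Delta_coeff n m \<noteq> 0"
proof -
  define p where "p i = (if i < n then n - Suc (Poly_Mapping.lookup m (X (Suc i))) else i)" for i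
  have "inj_on p {0..<n}"
  proof (rule inj_onI)
    fix i j assume ij: "i \<in> {0..<n}" "j \<in> {0..<n}" "p i = p j"
    then have "Poly_Mapping.lookup m (X (Suc i)) = Poly_Mapping.lookup m (X (Suc j))"
      using less[of "Suc i"] less[of "Suc j"] by (auto simp: p_def)
    then show "i = j" using inj_onD[OF inj, of "Suc i" "Suc j"] ij by auto
  qed
  moreover have "p ` {0..<n} \<subseteq> {0..<n}" by (auto simp: p_def)
  moreover have "p i = i" if "i \<notin> {0..<n}" for i using that by (simp add: p_def)
  ultimately have p: "p permutes {0..<n}"
    by (intro bij_imp_permutes) (auto simp: bij_betw_def endo_inj_surj)
  have m: "m = Delta_monom n p"
  proof (rule monom_eqI)
    fix i
    show "Poly_Mapping.lookup m (X i) = Poly_Mapping.lookup (Delta_monom n p) (X i)"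
      using assms(1)[of i] less[of i] by (cases i) (auto simp: p_def)
  qed (simp add: assms(2))
  have "Delta_coeff n m = (\<Sum>q | q permutes {0..<n}. if q = p then of_int (sign p) else 0)"
    unfolding Delta_coeff_eq m by (rule sum.cong) (auto simp: Delta_monom_inject[OF p])
  also have "\<dots> = of_int (sign p)"
    using p by (simp add: sum.delta' finite_permutations)
  finally show ?thesis by (simp add: sign_def)
qed

lemma xdeg_add: "xdeg n (m + m') = xdeg n m + xdeg n m'"
  by (simp add: xdeg_def lookup_add sum.distrib)

lemma ydeg_add: "ydeg n (m + m') = ydeg n m + ydeg n m'"
  by (simp add: ydeg_def lookup_add sum.distrib)

lemma xdeg_single [simp]:
  "xdeg n (x_pow i a) = (if i \<in> {1..n} then a else 0)" "xdeg n (y_pow i a) = 0"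
  by (simp_all add: xdeg_def lookup_single when_def sum.delta)

lemma ydeg_single [simp]:
  "ydeg n (y_pow i a) = (if i \<in> {1..n} then a else 0)" "ydeg n (x_pow i a) = 0"
  by (simp_all add: ydeg_def lookup_single when_def sum.delta)

lemma Delta_coeff_support:
  assumes "Delta_coeff n m \<noteq> 0"
  shows "Poly_Mapping.keys m \<subseteq> X ` {1..n}" "xdeg n m = n * (n - 1) div 2"
proof -
  from assms obtain p where p: "p permutes {0..<n}" and m: "m = Delta_monom n p"
    unfolding Delta_coeff_eq by (force elim: sum.not_neutral_contains_not_neutral split: if_splits)
  show "Poly_Mapping.keys m \<subseteq> X ` {1..n}"
  proof
    fix v assume v: "v \<in> Poly_Mapping.keys m"
    show "v \<in> X ` {1..n}"
    proof (cases v)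
      case (X j)
      with v show ?thesis by (cases j) (auto simp: m in_keys_iff split: if_splits)
    next
      case (Y j)
      with v show ?thesis by (simp add: m in_keys_iff)
    qed
  qed
  have "xdeg n m = (\<Sum>i<n. n - Suc (p i))"
    unfolding xdeg_def m by (simp add: sum.atLeast1_atMost_eq)
  also have "\<dots> = (\<Sum>i<n. n - Suc i)"
    using sum.permute[OF p, of "\<lambda>i. n - Suc i"] by (simp add: lessThan_atLeast0 o_def)
  also have "\<dots> = (\<Sum>i<n. i)"
    by (rule sum.nat_diff_reindex)
  finally show "xdeg n m = n * (n - 1) div 2"
    by (simp add: Sum_Ico_nat lessThan_atLeast0)
qed

lemma Delta_coeff_eq_0_if_Y:
  assumes "Poly_Mapping.lookup m (Y j) \<noteq> 0"
  shows "Delta_coeff n m = 0"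
proof (rule ccontr)
  assume "Delta_coeff n m \<noteq> 0"
  moreover have "Y j \<in> Poly_Mapping.keys m" using assms by (simp add: in_keys_iff)
  ultimately show False using Delta_coeff_support(1) by blast
qed

lemma alternating_power_sum:
  assumes "alternating_coeffs n C"
  shows "alternating_coeffs n (\<lambda>m. \<Sum>i = 1..n. C (m + x_pow i a))"
  unfolding alternating_coeffs_def
proof (intro allI impI)
  fix \<sigma> m assume \<sigma>: "\<sigma> permutes {1..n}"
  then have bij: "bij \<sigma>" by (rule permutes_bij)
  have "(\<Sum>i = 1..n. C (permute_monom \<sigma> m + x_pow i a)) = (\<Sum>i = 1..n. C (permute_monom \<sigma> m + x_pow (\<sigma> i) a))"
    by (subst sum.permute[OF \<sigma>]) (simp add: o_def)
  also have "\<dots> = (\<Sum>i = 1..n. C (permute_monom \<sigma> (m + x_pow i a)))"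
    by (simp add: permute_monom_add[OF bij] permute_monom_single)
  also have "\<dots> = of_int (sign \<sigma>) * (\<Sum>i = 1..n. C (m + x_pow i a))"
    using assms \<sigma> by (simp add: alternating_coeffs_def sum_distrib_left)
  finally show "(\<Sum>i = 1..n. C (permute_monom \<sigma> m + x_pow i a)) =
      of_int (sign \<sigma>) * (\<Sum>i = 1..n. C (m + x_pow i a))" .
qed

text \<open>Induction on the maximum: the largest element is at least the number of elements below
  it. This bounds from below the degree of a monomial with distinct exponents.\<close>

lemma sum_lessThan_card_le:
  fixes A :: "nat set"
  assumes "finite A"
  shows "\<Sum>{..<card A} \<le> \<Sum>A"
  using assms
proof (induction A rule: finite_linorder_max_induct)
  case empty
  then show ?case by simp
next
  case (insert b A)
  then have "A \<subseteq> {..<b}" by auto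
  then have "card A \<le> b" using card_mono[of "{..<b}" A] by simp
  moreover have "b \<notin> A" using insert by auto
  ultimately show ?case using insert by simp
qed

text \<open>A power sum in the \<open>\<partial>\<^sub>x\<close> maps \<open>Delta n\<close> to an alternating polynomial of degree
  below \<open>n (n - 1) / 2\<close>, hence to zero.\<close>

lemma power_sums_kill_Delta: "power_sums_kill n (Delta_coeff n)"
  unfolding power_sums_kill_def
proof (intro allI impI, rule ccontr)
  fix a m assume a: "(1::nat) \<le> a" and nz: "(\<Sum>i = 1..n. Delta_coeff n (m + x_pow i a)) \<noteq> 0"
  from nz obtain i where i: "i \<in> {1..n}" "Delta_coeff n (m + x_pow i a) \<noteq> 0"
    by (rule sum.not_neutral_contains_not_neutral)
  have Y0: "Poly_Mapping.lookup m (Y j) = 0" for j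
    using Delta_coeff_eq_0_if_Y[of "m + x_pow i a" j n] i(2)
    by (cases "Poly_Mapping.lookup m (Y j) = 0") (simp_all add: lookup_add)
  have deg: "xdeg n m < n * (n - 1) div 2"
    using Delta_coeff_support(2)[OF i(2)] i(1) a by (simp add: xdeg_add)
  \<comment> \<open>Distinct exponents would require x-degree at least \<open>n (n - 1) / 2\<close>.
    A repetition contradicts alternation, as all y-exponents are 0.\<close>
  have "\<not> inj_on (\<lambda>j. Poly_Mapping.lookup m (X j)) {1..n}"
  proof
    assume inj: "inj_on (\<lambda>j. Poly_Mapping.lookup m (X j)) {1..n}"
    have "xdeg n m = \<Sum>((\<lambda>j. Poly_Mapping.lookup m (X j)) ` {1..n})"
      unfolding xdeg_def using sum.reindex[OF inj, of "\<lambda>x. x"] by (simp add: o_def)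
    with sum_lessThan_card_le[of "(\<lambda>j. Poly_Mapping.lookup m (X j)) ` {1..n}"]
    have "\<Sum>{..<n} \<le> xdeg n m" using card_image[OF inj] by simp
    with deg show False by (simp add: Sum_Ico_nat lessThan_atLeast0)
  qed
  then obtain j k where "j \<in> {1..n}" "k \<in> {1..n}" "j \<noteq> k"
    "Poly_Mapping.lookup m (X j) = Poly_Mapping.lookup m (X k)"
    unfolding inj_on_def by blast
  with alternating_coeffs_eq_0[OF alternating_power_sum[OF alternating_Delta], of j n k m a] nz
  show False by (simp add: Y0)
qed

subsection \<open>The polynomials \<open>E n k (Delta n)\<close>\<close>

lemma divided_coeff_E:
  "divided_coeff (E n k P) m =
    (\<Sum>j = 1..n. of_nat (Poly_Mapping.lookup m (Y j)) * divided_coeff P (m - y_pow j 1 + x_pow j k))"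
  by (simp add: E_def divided_coeff_sum divided_coeff_Var_times divided_coeff_pderiv_pow)

text \<open>The operator \<open>E n k\<close> commutes with x-derivatives and with permutations, and
  lowers the x-degree by \<open>k\<close>. The case \<open>k = 0\<close> is included on purpose: it
  supplies the only candidate there, excluded later by a y-derivative.\<close>

lemma x_harmonic_E_Delta: "x_harmonic_coeffs n (int k) (divided_coeff (E n k (Delta n)))"
  unfolding x_harmonic_coeffs_def
proof (intro conjI allI impI)
  let ?C = "divided_coeff (E n k (Delta n))"
  show "power_sums_kill n ?C"
    unfolding power_sums_kill_def
  proof (intro allI impI)
    fix a m assume "(1::nat) \<le> a"
    let ?f = "\<lambda>i j. of_nat (Poly_Mapping.lookup m (Y j)) * Delta_coeff n (m - y_pow j 1 + x_pow j k + x_pow i a)"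
    have "(\<Sum>i = 1..n. ?C (m + x_pow i a)) = (\<Sum>i = 1..n. \<Sum>j = 1..n. ?f i j)"
      unfolding divided_coeff_E
    proof (intro sum.cong refl)
      fix i j
      show "of_nat (Poly_Mapping.lookup (m + x_pow i a) (Y j)) *
          Delta_coeff n (m + x_pow i a - y_pow j 1 + x_pow j k) = ?f i j"
      proof (cases "Poly_Mapping.lookup m (Y j) = 0")
        case True
        then show ?thesis by (simp add: lookup_add lookup_single)
      next
        case False
        have "m + x_pow i a - y_pow j 1 + x_pow j k = m - y_pow j 1 + x_pow j k + x_pow i a"
          by (rule monom_eqI) (auto simp: lookup_add lookup_minus lookup_single when_def)
        then show ?thesis by (simp add: lookup_add lookup_single)
      qed
    qed
    also have "\<dots> = (\<Sum>j = 1..n. \<Sum>i = 1..n. ?f i j)" by (rule sum.swap)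
    also have "\<dots> = 0"
      using power_sums_kill_Delta[of n] \<open>1 \<le> a\<close>
      by (simp add: power_sums_kill_def flip: sum_distrib_left)
    finally show "(\<Sum>i = 1..n. ?C (m + x_pow i a)) = 0" .
  qed
  show "alternating_coeffs n ?C"
    unfolding alternating_coeffs_def
  proof (intro allI impI)
    fix \<sigma> m assume \<sigma>: "\<sigma> permutes {1..n}"
    then have bij: "bij \<sigma>" by (rule permutes_bij)
    have diff: "permute_monom \<sigma> m - y_pow (\<sigma> j) 1 + x_pow (\<sigma> j) k = permute_monom \<sigma> (m - y_pow j 1 + x_pow j k)" for j
      by (rule permute_monom_eqI[OF bij, symmetric])
        (auto simp: lookup_add lookup_minus lookup_single when_def bij_is_inj[OF bij]
          inj_eq[OF bij_is_inj[OF bij]])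
    have "?C (permute_monom \<sigma> m) = (\<Sum>j = 1..n. of_nat (Poly_Mapping.lookup m (Y j)) *
        Delta_coeff n (permute_monom \<sigma> (m - y_pow j 1 + x_pow j k)))"
      unfolding divided_coeff_E
      by (subst sum.permute[OF \<sigma>]) (simp add: o_def bij_is_inj[OF bij] diff[simplified])
    also have "\<dots> = of_int (sign \<sigma>) * ?C m"
      using alternating_Delta[of n] \<sigma>
      by (simp add: alternating_coeffs_def divided_coeff_E sum_distrib_left mult.left_commute)
    finally show "?C (permute_monom \<sigma> m) = of_int (sign \<sigma>) * ?C m" .
  qed
next
  fix m assume "divided_coeff (E n k (Delta n)) m \<noteq> 0"
  then obtain j where j: "j \<in> {1..n}" and Yj: "Poly_Mapping.lookup m (Y j) \<noteq> 0"
    and nz: "Delta_coeff n (m - y_pow j 1 + x_pow j k) \<noteq> 0"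
    unfolding divided_coeff_E
    by (elim sum.not_neutral_contains_not_neutral) (auto simp del: divided_coeff_eq_0_iff)
  define m' where "m' = m - y_pow j 1"
  have m: "m = m' + y_pow j 1"
    using single_1_add_diff[OF Yj] by (simp add: m'_def add.commute)
  note supp = Delta_coeff_support[OF nz[folded m'_def]]
  have "Poly_Mapping.keys m' \<subseteq> Poly_Mapping.keys (m' + x_pow j k)"
    by (auto simp: in_keys_iff lookup_add)
  with supp(1) have keys: "Poly_Mapping.keys m' \<subseteq> X ` {1..n}" by blast
  then show "Poly_Mapping.keys m \<subseteq> X ` {1..n} \<union> Y ` {1..n}"
    using keys_add[of m' "y_pow j 1"] j unfolding m by auto
  show "int (xdeg n m) = int (n * (n - 1) div 2) - int k"
    using supp(2) j by (simp add: m xdeg_add)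
  have "ydeg n m' = 0"
    using keys by (auto simp: ydeg_def in_keys_iff)
  then show "ydeg n m = 1" using j by (simp add: m ydeg_add)
qed

section \<open>The spaces \<open>A_bideg n k 1\<close>\<close>

text \<open>In y-degree 1 the harmonicity conditions with \<open>b \<ge> 2\<close> hold
  automatically, \<open>b = 0\<close> gives \<open>power_sums_kill\<close>, and \<open>b = 1\<close>
  remains, with \<open>a = 0\<close> allowed.\<close>

lemma A_bideg_1_iff:
  "P \<in> A_bideg n k 1 \<longleftrightarrow> x_harmonic_coeffs n k (divided_coeff P) \<and>
    (\<forall>a m. (\<Sum>i = 1..n. divided_coeff P (m + x_pow i a + y_pow i 1)) = 0)"
proof -
  have harmonic: "diag_harmonic n P \<longleftrightarrow> power_sums_kill n (divided_coeff P) \<and>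
      (\<forall>a m. (\<Sum>i = 1..n. divided_coeff P (m + x_pow i a + y_pow i 1)) = 0)"
    if P: "\<forall>m\<in>Poly_Mapping.keys P. ydeg n m = 1"
  proof
    assume "diag_harmonic n P"
    note * = this[unfolded diag_harmonic_iff, rule_format]
    show "power_sums_kill n (divided_coeff P) \<and>
        (\<forall>a m. (\<Sum>i = 1..n. divided_coeff P (m + x_pow i a + y_pow i 1)) = 0)"
      using *[of _ 0] *[of _ 1] by (simp add: power_sums_kill_def)
  next
    assume *: "power_sums_kill n (divided_coeff P) \<and>
        (\<forall>a m. (\<Sum>i = 1..n. divided_coeff P (m + x_pow i a + y_pow i 1)) = 0)"
    show "diag_harmonic n P"
      unfolding diag_harmonic_iff
    proof (intro allI impI)
      fix a b :: nat and m assume "a + b > 0"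
      consider "b = 0" | "b = 1" | "b \<ge> 2" by linarith
      then show "(\<Sum>i = 1..n. divided_coeff P (m + x_pow i a + y_pow i b)) = 0"
      proof cases
        case 1
        then show ?thesis using * \<open>a + b > 0\<close> by (simp add: power_sums_kill_def)
      next
        case 2
        then show ?thesis using * by simp
      next
        case 3
        have "m + x_pow i a + y_pow i b \<notin> Poly_Mapping.keys P" if "i \<in> {1..n}" for i
        proof
          assume "m + x_pow i a + y_pow i b \<in> Poly_Mapping.keys P"
          then have "ydeg n (m + x_pow i a + y_pow i b) = 1" using P by blast
          then show False using that 3 by (simp add: ydeg_add)
        qed
        then show ?thesis by (intro sum.neutral) simp
      qed
    qed
  qed
  show ?thesis
    unfolding A_bideg_def A_def polys_def x_harmonic_coeffs_def alternating_iff divided_coeff_eq_0_iff not_not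
    using harmonic by blast
qed

lemma x_harmonic_coeffs_diff_scale:
  assumes "x_harmonic_coeffs n k (divided_coeff P)" "x_harmonic_coeffs n k (divided_coeff Q)"
  shows "x_harmonic_coeffs n k (divided_coeff (P - scale c Q))"
proof -
  have C: "divided_coeff (P - scale c Q) m = divided_coeff P m - c * divided_coeff Q m" for m
    by (simp add: divided_coeff_diff divided_coeff_scale)
  have "divided_coeff P m \<noteq> 0 \<or> divided_coeff Q m \<noteq> 0" if "divided_coeff (P - scale c Q) m \<noteq> 0" for m
    using that unfolding C by (auto simp del: divided_coeff_eq_0_iff)
  moreover have "power_sums_kill n (divided_coeff (P - scale c Q))"
    using assms by (simp add: x_harmonic_coeffs_def power_sums_kill_def C sum_subtractf flip: sum_distrib_left)
  moreover have "alternating_coeffs n (divided_coeff (P - scale c Q))"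
    using assms by (simp add: x_harmonic_coeffs_def alternating_coeffs_def C algebra_simps)
  ultimately show ?thesis
    using assms unfolding x_harmonic_coeffs_def by blast
qed

text \<open>Only \<open>y_n\<close> occurs in the gap monomial, so a single summand of
  \<open>E n k\<close> contributes. It trades \<open>y_n\<close> for \<open>x_n ^ k\<close>, which
  fills the gap and produces all exponents \<open>0, ..., n - 1\<close> once.\<close>

lemma E_Delta_gap_monom_nonzero:
  assumes "k < n"
  shows "divided_coeff (E n k (Delta n)) (gap_monom n k 0) \<noteq> 0"
proof -
  define m where "m = gap_monom n k 0 - y_pow n 1 + x_pow n k"
  have mX: "Poly_Mapping.lookup m (X i) = (if i = n then k else if i \<in> {1..<n} then gap_exp k i else 0)" for i
    by (simp add: m_def lookup_add lookup_minus lookup_gap_monom_X lookup_single)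
  have mY: "Poly_Mapping.lookup m (Y i) = 0" for i
    by (simp add: m_def lookup_add lookup_minus lookup_gap_monom_Y lookup_single)
  have gap: "gap_exp k i < n" "gap_exp k i \<noteq> k" if "i \<in> {1..<n}" for i
    using bij_betw_apply[OF bij_betw_gap_exp[OF assms] that] by auto
  have inj: "inj_on (gap_exp k) {1..<n}"
    using bij_betw_gap_exp[OF assms] by (simp add: bij_betw_def)
  have ins: "{1..n} = insert n {1..<n}" using assms by auto
  have "inj_on (\<lambda>i. Poly_Mapping.lookup m (X i)) {1..n}"
    unfolding ins
  proof (rule inj_onI)
    fix x y assume "x \<in> insert n {1..<n}" "y \<in> insert n {1..<n}"
      "Poly_Mapping.lookup m (X x) = Poly_Mapping.lookup m (X y)"
    then show "x = y"
      using gap(2)[of x] gap(2)[of y] inj_onD[OF inj, of x y] by (auto simp: mX split: if_splits)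
  qed
  then have "Delta_coeff n m \<noteq> 0"
    using gap(1) assms by (intro Delta_coeff_nonzero) (assumption | auto simp: mX mY)+
  moreover have "divided_coeff (E n k (Delta n)) (gap_monom n k 0) =
      (\<Sum>j = 1..n. if j = n then Delta_coeff n m else 0)"
    unfolding divided_coeff_E by (intro sum.cong) (auto simp: lookup_gap_monom_Y m_def)
  ultimately show ?thesis using assms by (simp add: sum.delta)
qed

lemma x_harmonic_multiple_E_Delta:
  assumes P: "x_harmonic_coeffs n (int k) (divided_coeff P)" and "k < n"
  obtains c where "P = scale c (E n k (Delta n))"
proof
  let ?Q = "E n k (Delta n)" and ?m = "gap_monom n k 0"
  \<comment> \<open>Chosen to cancel the one coefficient that determines all others.\<close>
  define c where "c = divided_coeff P ?m / divided_coeff ?Q ?m"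
  have "divided_coeff (P - scale c ?Q) ?m = 0"
    using E_Delta_gap_monom_nonzero[OF assms(2)]
    by (simp add: divided_coeff_diff divided_coeff_scale c_def del: divided_coeff_eq_0_iff)
  then have "divided_coeff (P - scale c ?Q) m = 0" for m
    using x_harmonic_coeffs_eq_0[OF x_harmonic_coeffs_diff_scale[OF P x_harmonic_E_Delta]]
    by simp
  then have "divided_coeff P = divided_coeff (scale c ?Q)"
    by (simp add: divided_coeff_diff fun_eq_iff del: divided_coeff_eq_0_iff)
  then show "P = scale c ?Q" by (simp only: divided_coeff_inject)
qed

text \<open>As \<open>Delta n\<close> is free of \<open>y\<close>, the derivative of
  \<open>E n k (Delta n)\<close> by \<open>Y i\<close> is the \<open>k\<close>-th derivative of
  \<open>Delta n\<close> by \<open>X i\<close>.\<close>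

lemma y_derivative_E_Delta:
  "(\<Sum>i = 1..n. divided_coeff (E n k (Delta n)) (m + x_pow i a + y_pow i 1)) =
    (\<Sum>i = 1..n. Delta_coeff n (m + x_pow i (a + k)))"
proof (rule sum.cong[OF refl])
  fix i assume i: "i \<in> {1..n}"
  let ?m = "m + x_pow i a + y_pow i 1"
  have "of_nat (Poly_Mapping.lookup ?m (Y j)) * Delta_coeff n (?m - y_pow j 1 + x_pow j k) =
    (if j = i then Delta_coeff n (m + x_pow i (a + k)) else 0)" for j
  proof (cases "j = i")
    case True
    have "?m - y_pow i 1 + x_pow i k = m + x_pow i (a + k)"
      by (simp only: add_diff_cancel_right') (simp only: single_add add.assoc)
    moreover have "Delta_coeff n (m + x_pow i (a + k)) = 0" if "Poly_Mapping.lookup m (Y i) \<noteq> 0"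
      using that by (intro Delta_coeff_eq_0_if_Y[of _ i]) (simp add: lookup_add)
    ultimately show ?thesis
      using True by (cases "Poly_Mapping.lookup m (Y i) = 0")
        (simp_all add: lookup_add lookup_single del: divided_coeff_eq_0_iff)
  next
    case False
    then have "Delta_coeff n (?m - y_pow j 1 + x_pow j k) = 0"
      by (intro Delta_coeff_eq_0_if_Y[of _ i]) (simp add: lookup_add lookup_minus lookup_single)
    then show ?thesis using False by simp
  qed
  then show "divided_coeff (E n k (Delta n)) ?m = Delta_coeff n (m + x_pow i (a + k))"
    using i by (simp only: divided_coeff_E) (simp add: sum.delta)
qed

text \<open>The y-conditions become power sums of order \<open>a + k\<close> applied to
  \<open>Delta n\<close>; \<open>1 \<le> k\<close> makes the order positive even for
  \<open>a = 0\<close>.\<close>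

lemma E_Delta_in_A_bideg: "1 \<le> k \<Longrightarrow> E n k (Delta n) \<in> A_bideg n (int k) 1"
  unfolding A_bideg_1_iff y_derivative_E_Delta
  using x_harmonic_E_Delta power_sums_kill_Delta by (auto simp: power_sums_kill_def)

lemma zero_in_A_bideg_1: "0 \<in> A_bideg n k 1"
  unfolding A_bideg_1_iff x_harmonic_coeffs_def power_sums_kill_def alternating_coeffs_def by simp

lemma scale_in_A_bideg_1: "P \<in> A_bideg n k 1 \<Longrightarrow> scale c P \<in> A_bideg n k 1"
  \<comment> \<open>The multiple is written as the difference
    \<open>0 - scale (- c) P\<close>.\<close>
  using x_harmonic_coeffs_diff_scale[of n k 0 P "- c"] zero_in_A_bideg_1[of n k]
  unfolding A_bideg_1_iff by (simp add: divided_coeff_scale flip: sum_distrib_left)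

lemma A_bideg_1_eq_span:
  assumes "1 \<le> k" "k < n"
  shows "A_bideg n (int k) 1 = qpoly.span {E n k (Delta n)}"
proof
  show "A_bideg n (int k) 1 \<subseteq> qpoly.span {E n k (Delta n)}"
  proof
    fix P assume "P \<in> A_bideg n (int k) 1"
    then have "x_harmonic_coeffs n (int k) (divided_coeff P)" by (simp only: A_bideg_1_iff)
    then obtain c where "P = scale c (E n k (Delta n))"
      using x_harmonic_multiple_E_Delta assms(2) by blast
    then show "P \<in> qpoly.span {E n k (Delta n)}" unfolding qpoly.span_singleton by blast
  qed
  show "qpoly.span {E n k (Delta n)} \<subseteq> A_bideg n (int k) 1"
    using scale_in_A_bideg_1[OF E_Delta_in_A_bideg[OF assms(1)]] by (auto simp: qpoly.span_singleton)
qed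

lemma A_bideg_1_eq_0:
  assumes "n \<ge> 1" and k: "\<not> (1 \<le> k \<and> k \<le> int n - 1)"
  shows "A_bideg n k 1 = {0}"
proof -
  have "P = 0" if "P \<in> A_bideg n k 1" for P
  proof (cases "k = 0")
    case True
    with that have P: "x_harmonic_coeffs n (int 0) (divided_coeff P)"
      and y: "(\<Sum>i = 1..n. divided_coeff P (m + x_pow i 0 + y_pow i 1)) = 0" for m
      by (auto simp only: A_bideg_1_iff of_nat_0)
    obtain c where c: "P = scale c (E n 0 (Delta n))"
      using x_harmonic_multiple_E_Delta[OF P] assms by auto
    \<comment> \<open>With \<open>a = 0\<close> and \<open>k = 0\<close> the y-condition sums
      \<open>n\<close> equal terms, that is, \<open>c n\<close> times \<open>Delta n\<close> must
      vanish.\<close>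
    have "c * (of_nat n * Delta_coeff n m) = 0" for m
      using y[of m] y_derivative_E_Delta[of n 0 m 0]
      by (simp add: c divided_coeff_scale flip: sum_distrib_left del: divided_coeff_eq_0_iff)
    moreover have "\<exists>m. Delta_coeff n m \<noteq> 0"
    proof (rule ccontr)
      assume "\<not> ?thesis"
      then have "divided_coeff (E n 0 (Delta n)) m = 0" for m
        by (simp add: divided_coeff_E del: divided_coeff_eq_0_iff)
      with E_Delta_gap_monom_nonzero[of 0 n] assms show False by auto
    qed
    ultimately have "c = 0" using assms by (auto simp del: divided_coeff_eq_0_iff)
    then show ?thesis by (simp add: c)
  next
    case False
    have "x_harmonic_coeffs n k (divided_coeff P)" using that by (simp only: A_bideg_1_iff)
    then have "divided_coeff P m = 0" for m
      \<comment> \<open>Here \<open>k\<close> is negative or at least \<open>n\<close>, so no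
        initial coefficient has to be checked.\<close>
      by (rule x_harmonic_coeffs_eq_0) (use False k in linarith)
    then have "divided_coeff P = divided_coeff 0" by (intro ext) (simp del: divided_coeff_eq_0_iff)
    then show ?thesis by (simp only: divided_coeff_inject)
  qed
  then show ?thesis using zero_in_A_bideg_1 by auto
qed

theorem mainTheorem4:
  fixes n :: nat
  assumes "n \<ge> 2"
  shows
    "(\<forall>k::nat. 1 \<le> k \<and> k \<le> n - 1 \<longrightarrow>
        qpoly.independent {E n k (Delta n)} \<and>
        qpoly.span {E n k (Delta n)} = A_bideg n (int k) 1 \<and>
        qpoly.dim (A_bideg n (int k) 1) = 1) \<and>
     (\<forall>k::int. \<not> (1 \<le> k \<and> k \<le> int n - 1) \<longrightarrow>
        A_bideg n k 1 = {0} \<and>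
        qpoly.dim (A_bideg n k 1) = 0)"
proof (rule conjI; intro allI impI)
  fix k :: nat assume "1 \<le> k \<and> k \<le> n - 1"
  with assms have k: "1 \<le> k" "k < n" by auto
  have "E n k (Delta n) \<noteq> 0"
    using E_Delta_gap_monom_nonzero[OF k(2)] by auto
  then have ind: "qpoly.independent {E n k (Delta n)}" by simp
  then show "qpoly.independent {E n k (Delta n)} \<and>
      qpoly.span {E n k (Delta n)} = A_bideg n (int k) 1 \<and>
      qpoly.dim (A_bideg n (int k) 1) = 1"
    using qpoly.dim_span_eq_card_independent[OF ind] A_bideg_1_eq_span[OF k] by simp
next
  fix k :: int assume "\<not> (1 \<le> k \<and> k \<le> int n - 1)"
  with assms have "A_bideg n k 1 = {0}" by (intro A_bideg_1_eq_0) auto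
  \<comment> \<open>The dimension is read off from the empty basis, as \<open>{}\<close> and
    \<open>{0}\<close> have the same span.\<close>
  then show "A_bideg n k 1 = {0} \<and> qpoly.dim (A_bideg n k 1) = 0"
    using qpoly.dim_span_eq_card_independent[of "{}"] qpoly.dim_span[of "{0}"]
    by (simp add: qpoly.independent_empty)
qed

end
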